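(* Let $q \ge 3$ be a prime power and let $V_2$ be a non-degenerate Hermitian surface in $\mathbb{P}^3$ over $\mathbb{F}_{q^2}$. For any nonzero homogeneous polynomial $F \in \mathbb{F}_{q^2}[x_0,x_1,x_2,x_3]$ of degree $3$ we have $$|\mathsf{V}(F) \cap V_2| \le 3(q^3+q^2-q)+q+1.$$ Moreover, if $q \ge 4$, then $$|\mathsf{V}(F) \cap V_2| = 3(q^3+q^2-q)+q+1 \quad\text{or}\quad |\mathsf{V}(F) \cap V_2| \le 3(q^3+q^2-q)+1.$$
   Context: A non-degenerate Hermitian surface $V_2$ is the zero set in $\mathbb{P}^3$ of $x^T A x^{(q)}$, where $x=(x_0,x_1,x_2,x_3)^T$, $x^{(q)}=(x_0^q,x_1^q,x_2^q,x_3^q)^T$, and $A=(a_{ij})$ is an invertible $4\times 4$ matrix over $\mathbb{F}_{q^2}$ with $A^T=A^{(q)}:=(a_{ij}^q)$. For a homogeneous polynomial $F$, $\mathsf{V}(F)$ denotes the set of $\mathbb{F}_{q^2}$-rational points of $\mathbb{P}^3$ at which $F$ vanishes. Thus $|\mathsf{V}(F)\cap V_2|$ is the number of $\mathbb{F}_{q^2}$-rational points common to the two surfaces. *)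

theory Defs
  imports
    "HOL-Analysis.Analysis"
    "HOL-Library.Poly_Mapping"
    "HOL-Number_Theory.Prime_Powers"
begin

text \<open>
  Polynomials over \<open>'a\<close> in variables indexed by the finite type \<open>'n\<close>: an exponent
  vector has type \<open>'n \<Rightarrow>\<^sub>0 nat\<close>, and a polynomial maps each exponent vector to its coefficient.
  For \<open>'n = 4\<close> these are the polynomials in \<open>x\<^sub>0, x\<^sub>1, x\<^sub>2, x\<^sub>3\<close>.
\<close>

type_synonym ('a, 'n) mpoly = "('n \<Rightarrow>\<^sub>0 nat) \<Rightarrow>\<^sub>0 'a"

definition mpoly_eval :: "('a::comm_semiring_1, 'n::finite) mpoly \<Rightarrow> 'a ^ 'n \<Rightarrow> 'a" where
  "mpoly_eval F x =
     (\<Sum>m\<in>Poly_Mapping.keys F.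
        Poly_Mapping.lookup F m * (\<Prod>i\<in>UNIV. x $ i ^ Poly_Mapping.lookup m i))"

definition homogeneous_mpoly :: "nat \<Rightarrow> ('a::zero, 'n::finite) mpoly \<Rightarrow> bool" where
  "homogeneous_mpoly d F \<longleftrightarrow>
     (\<forall>m\<in>Poly_Mapping.keys F. (\<Sum>i\<in>UNIV. Poly_Mapping.lookup m i) = d)"

definition proj_rel :: "(('a::field ^ 'n::finite) \<times> ('a ^ 'n)) set" where
  "proj_rel = {(x, y). x \<noteq> 0 \<and> y \<noteq> 0 \<and> (\<exists>c. c \<noteq> 0 \<and> y = c *s x)}"

definition proj_space :: "('a::field ^ 'n::finite) set set" where
  "proj_space = {x. x \<noteq> 0} // proj_rel"

lemma equiv_proj_rel: "equiv {x :: 'a::field ^ 'n::finite. x \<noteq> 0} proj_rel"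
proof (rule equivI)
  show "proj_rel \<subseteq> {x :: 'a ^ 'n. x \<noteq> 0} \<times> {x. x \<noteq> 0}"
    by (auto simp: proj_rel_def)
  show "refl_on {x :: 'a ^ 'n. x \<noteq> 0} proj_rel"
    by (auto simp: refl_on_def proj_rel_def intro: exI[of _ 1])
  show "sym (proj_rel :: (('a ^ 'n) \<times> ('a ^ 'n)) set)"
  proof (rule symI)
    fix x y :: "'a ^ 'n"
    assume "(x, y) \<in> proj_rel"
    then obtain c where "x \<noteq> 0" "y \<noteq> 0" "c \<noteq> 0" "y = c *s x"
      by (auto simp: proj_rel_def)
    then show "(y, x) \<in> proj_rel"
      by (auto simp: proj_rel_def vector_smult_assoc intro!: exI[of _ "inverse c"])
  qed
  show "trans (proj_rel :: (('a ^ 'n) \<times> ('a ^ 'n)) set)"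
    by (rule transI) (auto simp: proj_rel_def vector_smult_assoc)
qed

text \<open>
  The set of rational points at which \<open>f\<close> vanishes.  It is applied only to functions for which
  vanishing does not depend on the chosen coordinate vector of a point.
\<close>

definition zero_locus :: "('a::field ^ 'n::finite \<Rightarrow> 'a) \<Rightarrow> ('a ^ 'n) set set" where
  "zero_locus f = {P \<in> proj_space. \<forall>x\<in>P. f x = 0}"

definition V :: "('a::field, 'n::finite) mpoly \<Rightarrow> ('a ^ 'n) set set" where
  "V F = zero_locus (mpoly_eval F)"

definition power_vec :: "'a::field ^ 'n::finite \<Rightarrow> nat \<Rightarrow> 'a ^ 'n" where
  "power_vec x q = (\<chi> i. (x $ i) ^ q)"

definition power_mat :: "'a::field ^ 'n::finite ^ 'm::finite \<Rightarrow> nat \<Rightarrow> 'a ^ 'n ^ 'm" where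
  "power_mat A q = (\<chi> i j. (A $ i $ j) ^ q)"

text \<open>\<open>hermitian_form q A x\<close> is \<open>x\<^sup>T A x\<^bsup>(q)\<^esup>\<close>.\<close>

definition hermitian_form :: "nat \<Rightarrow> 'a::field ^ 'n::finite ^ 'n \<Rightarrow> 'a ^ 'n \<Rightarrow> 'a" where
  "hermitian_form q A x = (\<Sum>i\<in>UNIV. x $ i * (A *v power_vec x q) $ i)"

text \<open>
  Intended for a ground field with \<open>q\<^sup>2\<close> elements; the variety is represented by its set of
  rational points, and \<open>'n = 4\<close> gives surfaces.
\<close>

definition nondegenerate_hermitian_variety ::
    "nat \<Rightarrow> ('a::field ^ 'n::finite) set set \<Rightarrow> bool" where
  "nondegenerate_hermitian_variety q X \<longleftrightarrow>
     (\<exists>A :: 'a ^ 'n ^ 'n. invertible A \<and> transpose A = power_mat A q \<and>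
        X = zero_locus (hermitian_form q A))"

end

theory Submission
  imports Defs
begin

text \<open>
  Let \<open>X\<close> be the Hermitian surface and let \<open>T\<^sub>P\<close> be its tangent plane at a point \<open>P\<close>, that is, the
  orthogonal space of \<open>P\<close>.  A line contained in \<open>X\<close> is called a generator.  When \<open>P\<close> runs
  through a generator \<open>l\<close>, the planes \<open>T\<^sub>P\<close> run through all planes containing \<open>l\<close>, and \<open>T\<^sub>P\<close> meets \<open>X\<close>
  in \<open>l\<close> and in \<open>q\<close> further generators through \<open>P\<close>.  So \<open>X\<close> is the union of \<open>l\<close> and of these
  \<open>q (q\<^sup>2 + 1)\<close> generators, and the zeros of a form on \<open>X\<close> can be counted plane by plane.

  The heart of the proof is the bound \<open>d q\<^sup>3 + (d - 1) q\<^sup>2 + 1\<close> for a form \<open>F\<close> of degree \<open>d \<le> q\<close>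
  that vanishes on a generator \<open>l\<close> but on no tangent plane (lemma \<open>card_zeros_le_generator\<close>).  Let
  \<open>\<mu>\<close> be the multiplicity of \<open>F\<close> along \<open>l\<close> and let \<open>e = d - \<mu>\<close>.  On \<open>T\<^sub>P\<close> the form \<open>F\<close> is the \<open>\<mu>\<close>-th
  power of an equation of \<open>l\<close> times a form \<open>R\<^sub>P\<close> of degree \<open>e\<close>.  If \<open>R\<^sub>P\<close> vanishes on \<open>b\<^sub>P\<close> of the \<open>q\<close>
  generators, it is divisible by their equations, so it has at most \<open>e - b\<^sub>P\<close> zeros on each of the
  remaining ones.  This leaves the sum of the \<open>b\<^sub>P\<close> to be bounded.  The plane \<open>T\<^sub>P\<close> depends on the
  \<open>q\<close>-th powers of the coordinates of \<open>P\<close>, therefore \<open>R\<^sub>P(P)\<close> is a polynomial of degree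
  \<open>\<mu> q + e\<close> in the parameter of \<open>P\<close> on \<open>l\<close>, and it is not zero because \<open>e < q\<close>.  A \<open>q\<close>-th
  power is constant up to order \<open>q\<close>, so near a point \<open>P\<close> this polynomial behaves as if the plane were
  fixed, where the restriction of \<open>R\<^sub>P\<close> to \<open>l\<close> vanishes at \<open>P\<close> to the order \<open>b\<^sub>P\<close>, because \<open>b\<^sub>P\<close> of its
  linear factors do.  Hence the sum of the \<open>b\<^sub>P\<close> is at most \<open>\<mu> q + e\<close>, and adding up the planes gives
  the bound.  If \<open>F\<close> vanishes on no generator, it has at most \<open>d\<close> zeros on each of the lines
  that are counted, which is a smaller number for the degrees 2 and 3.

  A cubic form that vanishes on no tangent plane is thereby settled.  Otherwise it has the equation
  of a tangent plane as a factor, and the cofactor is a quadratic form to which the same dichotomy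
  applies, then a linear form.  What remains is a product of three equations of tangent planes.
  Two different tangent planes have \<open>q + 1\<close> or \<open>q\<^sup>2 + 1\<close> common points on \<open>X\<close>, and three of them either
  have at most one, or one of the pairwise intersections lies in the third plane.  In
  the second case the maximal value arises when the two other intersections have \<open>q + 1\<close> points.
\<close>


section \<open>Fields of square order\<close>

lemma of_nat_card_eq_0: "of_nat CARD('a) = (0 :: 'a :: {ring_1, finite})"
proof -
  have "(\<Sum>x\<in>(UNIV :: 'a set). x) = (\<Sum>x\<in>UNIV. x + 1)"
    by (rule sum.reindex_bij_witness[of _ "\<lambda>x. x + 1" "\<lambda>x. x - 1"]) auto
  then show ?thesis
    by (simp add: sum.distrib)
qed

lemma power_card_eq_same:
  fixes x :: "'a :: {field, finite}"
  shows "x ^ CARD('a) = x"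
proof (cases "x = 0")
  case False
  have "(\<Prod>y\<in>UNIV - {0}. x * y) = (\<Prod>y\<in>UNIV - {0}. y)"
    by (rule prod.reindex_bij_witness[of _ "\<lambda>y. y / x" "\<lambda>y. x * y"]) (use False in auto)
  then have "x ^ (CARD('a) - 1) = 1"
    by (simp add: prod.distrib card_Diff_subset)
  moreover have "CARD('a) = Suc (CARD('a) - 1)"
    by simp
  ultimately show ?thesis
    by (metis mult.right_neutral power_Suc)
qed (simp add: zero_power)

lemma frobenius_add:
  fixes x y :: "'a :: {field, finite}"
  assumes "primepow q" and "CARD('a) = q ^ 2"
  shows "(x + y) ^ q = x ^ q + y ^ q"
proof -
  obtain p k where p: "prime p" "q = p ^ k"
    using assms(1) by (auto simp: primepow_def)
  have "CHAR('a) > 0"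
    by (rule finite_imp_CHAR_pos) simp
  then have char: "prime CHAR('a)"
    by (rule prime_CHAR_semidom)
  have "of_nat (q ^ 2) = (0 :: 'a)"
    using of_nat_card_eq_0[where ?'a = 'a] assms(2) by simp
  then have "CHAR('a) dvd p ^ (k * 2)"
    using p(2) by (simp only: of_nat_eq_0_iff_char_dvd power_mult)
  then have "CHAR('a) = p"
    using char p(1) prime_dvd_power primes_dvd_imp_eq by blast
  then show ?thesis
    using freshmans_dream'[of q k x y] char p by simp
qed

text \<open>
  A double count without slack: if the fibres have at most \<open>k\<close> elements, the codomain has at
  most \<open>m\<close> and the domain has exactly \<open>k m\<close>, then all fibres are as large as possible.
\<close>

lemma card_fibre_eq:
  fixes f :: "'b \<Rightarrow> 'c"
  assumes "finite A" and "finite B" and "f ` A \<subseteq> B"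
    and le: "\<And>b. b \<in> B \<Longrightarrow> card {a \<in> A. f a = b} \<le> k"
    and "card B \<le> m" and "card A = k * m" and "b \<in> B"
  shows "card {a \<in> A. f a = b} = k"
proof (rule ccontr)
  assume "card {a \<in> A. f a = b} \<noteq> k"
  then have less: "card {a \<in> A. f a = b} < k"
    using le[OF \<open>b \<in> B\<close>] by simp
  have "card A = card (\<Union>b\<in>B. {a \<in> A. f a = b})"
    using assms(3) by (intro arg_cong[where f = card]) auto
  also have "\<dots> = (\<Sum>b\<in>B. card {a \<in> A. f a = b})"
    using assms(1,2) by (intro card_UN_disjoint) auto
  also have "\<dots> < (\<Sum>b\<in>B. k)"
    using assms(2,7) less le by (intro sum_strict_mono_ex1) auto
  also have "\<dots> \<le> k * m"
    using assms(5) by simp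
  finally show False
    using assms(6) by simp
qed

lemma card_poly_eq_le:
  fixes p :: "'a :: idom poly"
  assumes "degree p > 0"
  shows "card {x. poly p x = c} \<le> degree p"
proof -
  have deg: "degree (p - [:c:]) = degree p"
    using assms degree_add_eq_left[of "- [:c:]" p] by (simp add: minus_poly_def del: minus_pCons)
  then have "p - [:c:] \<noteq> 0"
    using assms by auto
  then have "card {x. poly (p - [:c:]) x = 0} \<le> degree p"
    using card_poly_roots_bound deg by metis
  then show ?thesis
    by simp
qed

context
  fixes q :: nat
  assumes q: "primepow q" and q3: "q \<ge> 3" and card: "CARD('a :: {field, finite}) = q ^ 2"
begin

lemma frobenius_frobenius: "((x :: 'a) ^ q) ^ q = x"
  using power_card_eq_same[of x] card by (simp add: power2_eq_square power_mult)

lemma card_fixed_by_frobenius: "card {x :: 'a. x ^ q = x} \<le> q"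
proof -
  let ?p = "monom 1 q - monom 1 1 :: 'a poly"
  have deg: "degree ?p = q"
    using q3 degree_add_eq_left[of "- monom 1 1" "monom 1 q :: 'a poly"]
    by (simp add: degree_monom_eq)
  show ?thesis
    using card_poly_eq_le[of ?p 0] deg q3 by (simp add: poly_monom)
qed

text \<open>
  The trace and the norm to the subfield of order \<open>q\<close> are polynomial maps of degree \<open>q\<close> and
  \<open>q + 1\<close>, so their fibres are small, and so is the subfield, which consists of the roots of
  \<open>x\<^sup>q - x\<close>. By \<open>card_fibre_eq\<close> neither map can miss a value of the subfield.
\<close>

lemma card_trace_fibre:
  assumes "b ^ q = b"
  shows "card {x :: 'a. x + x ^ q = b} = q"
proof -
  let ?p = "monom 1 q + monom 1 1 :: 'a poly"
  have deg: "degree ?p = q"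
    using q3 degree_add_eq_left[of "monom 1 1" "monom 1 q :: 'a poly"]
    by (simp add: degree_monom_eq)
  have "card {x \<in> UNIV. x + x ^ q = b} = q"
  proof (rule card_fibre_eq[where B = "{x. x ^ q = x}" and m = q])
    show "(\<lambda>x. x + x ^ q) ` UNIV \<subseteq> {x :: 'a. x ^ q = x}"
      by (auto simp: frobenius_add[OF q card] frobenius_frobenius add.commute)
    show "card {a \<in> UNIV. a + a ^ q = b} \<le> q" for b :: 'a
      using card_poly_eq_le[of ?p b] deg q3 by (simp add: poly_monom add.commute)
  qed (use assms card card_fixed_by_frobenius in \<open>auto simp: power2_eq_square\<close>)
  then show ?thesis
    by simp
qed

lemma norm_surj:
  assumes "b ^ q = b"
  shows "\<exists>x :: 'a. x ^ (q + 1) = b"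
proof (cases "b = 0")
  case True
  then show ?thesis
    by (intro exI[of _ 0]) simp
next
  case False
  let ?B = "{x. x ^ q = x} - {0 :: 'a}"
  have nz: "x ^ (q + 1) \<noteq> 0" if "x \<noteq> 0" for x :: 'a
    using that by simp
  have "card {x \<in> UNIV - {0}. x ^ (q + 1) = b} = q + 1"
  proof (rule card_fibre_eq[where B = ?B and m = "q - 1"])
    show "(\<lambda>x. x ^ (q + 1)) ` (UNIV - {0}) \<subseteq> ?B"
      using nz by (auto simp: power_mult_distrib frobenius_frobenius mult.commute)
    show "card {a \<in> UNIV - {0}. a ^ (q + 1) = b} \<le> q + 1" for b :: 'a
    proof -
      have "card {x. poly (monom 1 (q + 1)) x = b} \<le> q + 1"
        using card_poly_eq_le[of "monom (1 :: 'a) (q + 1)" b] by (simp add: degree_monom_eq)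
      moreover have "card {a \<in> UNIV - {0}. a ^ (q + 1) = b} \<le> card {x. poly (monom 1 (q + 1)) x = b}"
        by (intro card_mono) (auto simp: poly_monom)
      ultimately show ?thesis
        by linarith
    qed
    have "card ?B = card {x :: 'a. x ^ q = x} - 1"
      using q3 by (subst card_Diff_singleton) auto
    then show "card ?B \<le> q - 1"
      using card_fixed_by_frobenius by linarith
    have "card (UNIV - {0 :: 'a}) = q ^ 2 - 1"
      using card by (simp add: card_Diff_singleton)
    also have "\<dots> = (q + 1) * (q - 1)"
      by (cases q) (auto simp: power2_eq_square algebra_simps)
    finally show "card (UNIV - {0 :: 'a}) = (q + 1) * (q - 1)" .
  qed (use assms False in auto)
  then have "card {x \<in> UNIV - {0}. x ^ (q + 1) = b} \<noteq> 0"
    by linarith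
  then have "{x \<in> UNIV - {0}. x ^ (q + 1) = b} \<noteq> {}"
    by (metis card.empty)
  then show ?thesis
    by blast
qed

end

section \<open>Homogeneous forms as functions\<close>

definition lin :: "'a::comm_ring_1 ^ 'n::finite \<Rightarrow> 'a ^ 'n \<Rightarrow> 'a" where
  "lin a x = (\<Sum>i\<in>UNIV. a $ i * x $ i)"

definition linear_fun :: "('a::comm_ring_1 ^ 'n::finite \<Rightarrow> 'a) \<Rightarrow> bool" where
  "linear_fun h \<longleftrightarrow> (\<forall>x y. h (x + y) = h x + h y) \<and> (\<forall>c x. h (c *s x) = c * h x)"

lemma linear_funI:
  "(\<And>x y. h (x + y) = h x + h y) \<Longrightarrow> (\<And>c x. h (c *s x) = c * h x) \<Longrightarrow> linear_fun h"
  by (simp add: linear_fun_def)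

lemma linear_fun_lin [simp]: "linear_fun (lin a)"
  by (simp add: linear_fun_def lin_def algebra_simps sum.distrib sum_distrib_left)

lemma linear_funD:
  assumes "linear_fun h"
  shows "h (x + y) = h x + h y" and "h (c *s x) = c * h x" and "h (x - y) = h x - h y"
    and "h 0 = 0" and "h (- x) = - h x"
proof -
  have h: "h (x + y) = h x + h y" "h (c *s x) = c * h x" for x y c
    using assms by (auto simp: linear_fun_def)
  show "h (x + y) = h x + h y" "h (c *s x) = c * h x"
    by (rule h)+
  show "h 0 = 0"
    using h(2)[of 0 0] by simp
  show "h (x - y) = h x - h y"
    using h(1)[of "x - y" y] by simp
  show "h (- x) = - h x"
    using h(1)[of x "- x"] h(2)[of 0 0] by (simp add: eq_neg_iff_add_eq_0 add.commute)
qed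

lemma linear_fun_eq_lin:
  fixes h :: "'a :: comm_ring_1 ^ 'n :: finite \<Rightarrow> 'a"
  assumes "linear_fun h"
  shows "\<exists>a. h = lin a"
proof -
  have sum: "h (\<Sum>i\<in>S. f i) = (\<Sum>i\<in>S. h (f i))" for S and f :: "'n \<Rightarrow> 'a ^ 'n"
    by (induction S rule: infinite_finite_induct) (simp_all add: linear_funD[OF assms])
  have "h x = lin (\<chi> i. h (axis i 1)) x" for x
  proof -
    have "h x = h (\<Sum>i\<in>UNIV. x $ i *s axis i 1)"
      by (simp add: basis_expansion)
    then show ?thesis
      by (simp add: sum linear_funD[OF assms] lin_def mult.commute)
  qed
  then show ?thesis
    by blast
qed

text \<open>
  Forms are treated as functions that are sums of products of linear forms. This makes
  restriction to a subspace and linear change of coordinates immediate, and as long as the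
  degree is less than the number of scalars nothing is lost by forgetting the
  coefficients.
\<close>

inductive form :: "nat \<Rightarrow> ('a::comm_ring_1 ^ 'n::finite \<Rightarrow> 'a) \<Rightarrow> bool" where
  const: "form 0 (\<lambda>x. c)"
| lin_mult: "form d f \<Longrightarrow> form (Suc d) (\<lambda>x. lin a x * f x)"
| add: "form d f \<Longrightarrow> form d g \<Longrightarrow> form d (\<lambda>x. f x + g x)"

lemma form_linear_mult:
  assumes "linear_fun h" and "form d f"
  shows "form (Suc d) (\<lambda>x. h x * f x)"
  using linear_fun_eq_lin[OF assms(1)] form.lin_mult[OF assms(2)] by auto

lemma form_zero: "form d (\<lambda>x. 0)"
proof (induction d)
  case (Suc d)
  show ?case
    using form.lin_mult[OF Suc, of 0] by simp
qed (rule form.const)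

lemma form_mult:
  assumes "form d f" and "form e g"
  shows "form (d + e) (\<lambda>x. f x * g x)"
  using assms
proof (induction rule: form.induct)
  case (const c)
  from const show ?case
  proof (induction rule: form.induct)
    case (const b)
    show ?case
      using form.const[of "c * b"] by simp
  next
    case (lin_mult d f a)
    then show ?case
      using form.lin_mult[of d "\<lambda>x. c * f x" a] by (simp add: mult.left_commute)
  next
    case (add d f g)
    then show ?case
      using form.add[of d "\<lambda>x. c * f x" "\<lambda>x. c * g x"] by (simp add: distrib_left)
  qed
next
  case (lin_mult d f a)
  then show ?case
    using form.lin_mult[of "d + e" "\<lambda>x. f x * g x" a] by (simp add: mult.assoc)
next
  case (add d f h)
  then show ?case
    using form.add[of "d + e" "\<lambda>x. f x * g x" "\<lambda>x. h x * g x"] by (simp add: distrib_right)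
qed

lemma form_smult: "form d f \<Longrightarrow> form d (\<lambda>x. c * f x)"
  using form_mult[OF form.const] by simp

lemma form_linear: "linear_fun h \<Longrightarrow> form 1 h"
  using form_linear_mult[OF _ form.const[of 1]] by simp

lemma form_sum:
  "(\<And>i. i \<in> S \<Longrightarrow> form d (f i)) \<Longrightarrow> form d (\<lambda>x. \<Sum>i\<in>S. f i x)"
  by (induction S rule: infinite_finite_induct) (auto intro: form_zero form.add)

lemma form_prod:
  "finite S \<Longrightarrow> (\<And>i. i \<in> S \<Longrightarrow> form (d i) (f i)) \<Longrightarrow> form (sum d S) (\<lambda>x. \<Prod>i\<in>S. f i x)"
  by (induction S rule: finite_induct) (auto intro: form.const form_mult)

lemma form_power: "form d f \<Longrightarrow> form (k * d) (\<lambda>x. f x ^ k)"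
  by (induction k) (auto intro: form.const form_mult)

lemma form_homogeneous:
  assumes "form d f"
  shows "f (c *s x) = c ^ d * f x"
  using assms by induction (auto simp: linear_funD[OF linear_fun_lin] algebra_simps)

lemma form_compose:
  fixes T :: "'a :: comm_ring_1 ^ 'm :: finite \<Rightarrow> 'a ^ 'n :: finite"
  assumes "form d f" and "\<And>x y. T (x + y) = T x + T y" and "\<And>c x. T (c *s x) = c *s T x"
  shows "form d (\<lambda>x. f (T x))"
  using assms(1)
proof induction
  case (lin_mult d f a)
  have "linear_fun (\<lambda>x. lin a (T x))"
    by (rule linear_funI) (simp_all add: assms(2,3) linear_funD[OF linear_fun_lin])
  then show ?case
    using form_linear_mult lin_mult by blast
qed (auto intro: form.intros)

lemma form_zero_degree: "form 0 f \<Longrightarrow> f x = f y"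
  by (induction "0 :: nat" f rule: form.induct) auto

text \<open>
  Division with remainder by a linear form \<open>h\<close>. The remainder is \<open>f\<close> evaluated at a shifted
  argument, and this argument is the projection to the kernel of \<open>h\<close> along \<open>e\<close> when \<open>h e = 1\<close>.
  The clause for degree 0, where \<open>d - 1\<close> is not smaller than \<open>d\<close>, is there to make the
  induction work.
\<close>

lemma form_project_along:
  assumes "form d f" and "linear_fun h"
  shows "\<exists>G. form (d - 1) G \<and> (d = 0 \<longrightarrow> G = (\<lambda>x. 0)) \<and>
           (\<forall>x. f x = f (x - h x *s e) + h x * G x)"
  using assms(1)
proof induction
  case (const c)
  show ?case
    by (rule exI[of _ "\<lambda>x. 0"]) (simp add: form_zero)
next
  case (lin_mult d f a)
  from lin_mult.IH obtain G where G: "form (d - 1) G" "d = 0 \<longrightarrow> G = (\<lambda>x. 0)"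
      "\<forall>x. f x = f (x - h x *s e) + h x * G x"
    by (elim exE conjE)
  let ?l = "\<lambda>x. lin a (x - h x *s e)"
  have l: "linear_fun ?l"
    by (rule linear_funI)
      (simp_all add: linear_funD[OF assms(2)] linear_funD[OF linear_fun_lin] algebra_simps)
  have "form d (\<lambda>x. ?l x * G x)"
  proof (cases d)
    case 0
    then show ?thesis
      using G(2) by (simp add: form.const)
  next
    case (Suc d')
    then show ?thesis
      using form_linear_mult[OF l G(1)] by simp
  qed
  moreover have "form d (\<lambda>x. lin a e * f x)"
    using lin_mult(1) by (rule form_smult)
  ultimately have form: "form d (\<lambda>x. ?l x * G x + lin a e * f x)"
    by (rule form.add)
  have eq: "lin a x * f x = ?l x * f (x - h x *s e) + h x * (?l x * G x + lin a e * f x)" for x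
    using G(3)[rule_format, of x] by (simp add: linear_funD[OF assms(2)] linear_funD[OF linear_fun_lin] algebra_simps)
  show ?case
    by (rule exI[of _ "\<lambda>x. ?l x * G x + lin a e * f x"])
      (use form in \<open>intro conjI allI eq; simp\<close>)
next
  case (add d f g)
  from add.IH obtain F G where FG: "form (d - 1) F" "d = 0 \<longrightarrow> F = (\<lambda>x. 0)"
      "\<forall>x. f x = f (x - h x *s e) + h x * F x"
      "form (d - 1) G" "d = 0 \<longrightarrow> G = (\<lambda>x. 0)"
      "\<forall>x. g x = g (x - h x *s e) + h x * G x"
    by (elim exE conjE)
  have eq: "f x + g x = f (x - h x *s e) + g (x - h x *s e) + h x * (F x + G x)" for x
    using FG(3)[rule_format, of x] FG(6)[rule_format, of x] by (simp add: algebra_simps)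
  show ?case
    by (rule exI[of _ "\<lambda>x. F x + G x"])
      (use form.add[OF FG(1,4)] FG(2,5) in \<open>intro conjI allI eq; simp\<close>)
qed

lemma form_divide:
  assumes "form d f" and "linear_fun h" and "h e = 1" and "\<And>x. h x = 0 \<Longrightarrow> f x = 0"
  shows "\<exists>G. form (d - 1) G \<and> (\<forall>x. f x = h x * G x)"
proof -
  obtain G where G: "form (d - 1) G" "d = 0 \<longrightarrow> G = (\<lambda>x. 0)"
      "\<forall>x. f x = f (x - h x *s e) + h x * G x"
    using form_project_along[OF assms(1,2), of e] by (elim exE conjE)
  have eq: "f x = h x * G x" for x
  proof -
    have "f (x - h x *s e) = 0"
      using assms(3) by (intro assms(4)) (simp add: linear_funD[OF assms(2)])
    then show ?thesis
      using G(3)[rule_format, of x] by simp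
  qed
  show ?thesis
    using G(1) eq by blast
qed

lemma form_divide_codim_2:
  assumes "form d f" and c: "linear_fun c" and e: "linear_fun e"
    and w: "c w = 1" "e w = 0" and z: "c z = 0" "e z = 1"
    and zero: "\<And>x. c x = 0 \<Longrightarrow> e x = 0 \<Longrightarrow> f x = 0"
  shows "\<exists>G H. form (d - 1) G \<and> form (d - 1) H \<and> (\<forall>x. f x = c x * G x + e x * H x)"
proof -
  obtain G where G: "form (d - 1) G" "d = 0 \<longrightarrow> G = (\<lambda>x. 0)"
      "\<forall>x. f x = f (x - c x *s w) + c x * G x"
    using form_project_along[OF assms(1) c, of w] by (elim exE conjE)
  have form: "form d (\<lambda>x. f (x - c x *s w))"
    using assms(1)
    by (rule form_compose) (simp_all add: linear_funD[OF c] algebra_simps vec.scale_right_diff_distrib)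
  have zero': "f (x - c x *s w) = 0" if "e x = 0" for x
    using that w by (intro zero) (simp_all add: linear_funD[OF c] linear_funD[OF e])
  have "\<exists>H. form (d - 1) H \<and> (\<forall>x. f (x - c x *s w) = e x * H x)"
    by (rule form_divide[OF form e z(2)]) (rule zero')
  then obtain H where H: "form (d - 1) H" "\<forall>x. f (x - c x *s w) = e x * H x"
    by (elim exE conjE)
  have "f x = c x * G x + e x * H x" for x
  proof -
    have "f x = f (x - c x *s w) + c x * G x"
      by (rule G(3)[rule_format])
    also have "\<dots> = c x * G x + e x * H x"
      by (simp only: H(2)[rule_format] add.commute)
    finally show ?thesis .
  qed
  then show ?thesis
    using G(1) H(1) by blast
qed

text \<open>
  The leading coefficient is the value at the point at infinity of the line.
\<close>

lemma form_on_line: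
  assumes "form d f"
  shows "\<exists>p. degree p \<le> d \<and> coeff p d = f y \<and> (\<forall>t. f (x + t *s y) = poly p t)"
  using assms
proof induction
  case (const c)
  show ?case
    by (rule exI[of _ "[:c:]"]) simp
next
  case (lin_mult d f a)
  from lin_mult.IH obtain p where p: "degree p \<le> d" "coeff p d = f y"
      "\<forall>t. f (x + t *s y) = poly p t"
    by (elim exE conjE)
  define l r where "l = [:lin a x, lin a y:]" and "r = l * p"
  have "degree l \<le> 1"
    using degree_pCons_le[of "lin a x" "[:lin a y:]"] by (simp add: l_def)
  then have deg: "degree r \<le> Suc d"
    using degree_mult_le[of l p] p(1) by (simp add: r_def)
  have "coeff p (Suc d) = 0"
    using p(1) by (simp add: coeff_eq_0)
  then have coeff: "coeff r (Suc d) = lin a y * f y"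
    using p(2) by (simp add: r_def l_def)
  have eval: "lin a (x + t *s y) * f (x + t *s y) = poly r t" for t
    using p(3) by (simp add: r_def l_def linear_funD[OF linear_fun_lin] distrib_right mult.assoc)
  show ?case
    by (rule exI[of _ r]) (use deg coeff in \<open>intro conjI allI eval; simp\<close>)
next
  case (add d f g)
  from add.IH obtain p r where p: "degree p \<le> d" "coeff p d = f y"
      "\<forall>t. f (x + t *s y) = poly p t" and r: "degree r \<le> d" "coeff r d = g y"
      "\<forall>t. g (x + t *s y) = poly r t"
    by (elim exE conjE)
  have eval: "f (x + t *s y) + g (x + t *s y) = poly (p + r) t" for t
    using p(3) r(3) by (simp only: poly_add)
  show ?case
    by (rule exI[of _ "p + r"])
      (use p(1,2) r(1,2) in \<open>intro conjI allI eval; simp add: degree_add_le\<close>)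
qed

lemma sum_vec_prod:
  fixes g :: "'n :: finite \<Rightarrow> 'a :: {comm_semiring_1, finite} \<Rightarrow> 'a"
  shows "(\<Sum>x\<in>(UNIV :: ('a ^ 'n) set). \<Prod>i\<in>UNIV. g i (x $ i)) = (\<Prod>i\<in>UNIV. \<Sum>c\<in>UNIV. g i c)"
proof -
  have "(\<Sum>x\<in>(UNIV :: ('a ^ 'n) set). \<Prod>i\<in>UNIV. g i (x $ i)) = (\<Sum>h\<in>UNIV. \<Prod>i\<in>UNIV. g i (h i))"
    by (rule sum.reindex_bij_witness[of _ vec_lambda vec_nth]) (auto simp: vec_lambda_beta)
  also have "\<dots> = (\<Sum>h\<in>PiE UNIV (\<lambda>_. UNIV). \<Prod>i\<in>UNIV. g i (h i))"
    by (simp add: PiE_UNIV_domain)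
  also have "\<dots> = (\<Prod>i\<in>UNIV. \<Sum>c\<in>UNIV. g i c)"
    by (subst prod_sum_PiE) auto
  finally show ?thesis .
qed

text \<open>
  Orthogonality of the power functions. The exponent \<open>CARD('a) - 1 - b\<close> stands for \<open>- b\<close>; it
  is positive, so that the scalar 0 contributes nothing.
\<close>

lemma sum_power_shifted:
  fixes a b :: nat
  assumes "a < CARD('a) - 1" and "b < CARD('a) - 1"
  shows "(\<Sum>c\<in>(UNIV :: 'a :: {field, finite} set). c ^ (a + (CARD('a) - 1 - b))) =
    (if a = b then - 1 else 0)"
proof -
  define N where "N = CARD('a) - 1"
  have N: "CARD('a) = Suc N"
    by (simp add: N_def)
  have cN: "c ^ N = 1" if "c \<noteq> 0" for c :: 'a
    using power_card_eq_same[of c] that by (simp add: N)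
  have ab: "a < N" "b < N"
    using assms by (simp_all add: N_def)
  show ?thesis
  proof (cases "a = b")
    case True
    have "(\<Sum>c\<in>(UNIV :: 'a set). c ^ N) = (\<Sum>c\<in>UNIV - {0 :: 'a}. c ^ N)"
      using ab by (intro sum.mono_neutral_right) auto
    also have "\<dots> = of_nat N"
      by (simp add: cN card_Diff_singleton N)
    also have "\<dots> = - 1"
      using of_nat_card_eq_0[where ?'a = 'a] by (simp add: N eq_neg_iff_add_eq_0 add.commute)
    finally show ?thesis
      using True ab by (simp add: N)
  next
    case False
    define e where "e = a + (N - b)"
    have e: "c ^ e * c ^ b = c ^ a" if "c \<noteq> 0" for c :: 'a
      using cN[OF that] ab by (simp add: e_def flip: power_add) (simp add: power_add)
    let ?p = "monom 1 a - monom 1 b :: 'a poly"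
    have p: "?p \<noteq> 0"
      using False by (simp add: monom_eq_iff')
    have "degree ?p < N"
      using ab degree_monom_le[of "1 :: 'a" a] degree_monom_le[of "1 :: 'a" b]
      by (intro degree_diff_less) (auto simp: degree_monom_eq)
    then have "card {c. poly ?p c = 0} < N"
      using card_poly_roots_bound[OF p] by linarith
    moreover have "card (UNIV - {0 :: 'a}) = N"
      by (simp add: card_Diff_singleton N)
    ultimately have "\<not> UNIV - {0} \<subseteq> {c. poly ?p c = 0}"
      using card_mono[of "{c. poly ?p c = 0}" "UNIV - {0}"] by auto
    then obtain c :: 'a where c: "c \<noteq> 0" "c ^ a \<noteq> c ^ b"
      by (auto simp: poly_monom)
    then have "c ^ e \<noteq> 1"
      using e[of c] by auto
    have "(\<Sum>x\<in>(UNIV :: 'a set). x ^ e) = (\<Sum>x\<in>UNIV. (c * x) ^ e)"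
      by (rule sum.reindex_bij_witness[of _ "\<lambda>x. c * x" "\<lambda>x. x / c"]) (use c in auto)
    also have "\<dots> = c ^ e * (\<Sum>x\<in>(UNIV :: 'a set). x ^ e)"
      by (simp add: power_mult_distrib sum_distrib_left)
    finally have "(\<Sum>x\<in>(UNIV :: 'a set). x ^ e) = 0"
      using \<open>c ^ e \<noteq> 1\<close> by simp
    then show ?thesis
      using False by (simp add: N e_def)
  qed
qed

text \<open>
  A coefficient of \<open>F\<close> can be recovered from the values of \<open>F\<close> by summing them, multiplied by
  the inverse of the corresponding monomial, over the whole space.
\<close>

lemma mpoly_eval_nonzero:
  fixes F :: "('a :: {field, finite}, 'n :: finite) mpoly"
  assumes "F \<noteq> 0"
    and small: "\<And>m i. m \<in> Poly_Mapping.keys F \<Longrightarrow> Poly_Mapping.lookup m i < CARD('a) - 1"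
  shows "\<exists>x. mpoly_eval F x \<noteq> 0"
proof (rule ccontr)
  let ?N = "CARD('a) - 1" and ?K = "Poly_Mapping.keys F" and ?l = Poly_Mapping.lookup
  assume "\<not> ?thesis"
  then have zero: "mpoly_eval F x = 0" for x
    by blast
  obtain m where m: "m \<in> ?K"
    using assms(1) by fastforce
  have mono: "(\<Sum>x\<in>UNIV. (\<Prod>i\<in>UNIV. x $ i ^ ?l k i) * (\<Prod>i\<in>UNIV. x $ i ^ (?N - ?l m i))) =
      (if k = m then (- 1) ^ CARD('n) else (0 :: 'a))" if "k \<in> ?K" for k
  proof -
    have "(\<Sum>x\<in>UNIV. (\<Prod>i\<in>UNIV. x $ i ^ ?l k i) * (\<Prod>i\<in>UNIV. x $ i ^ (?N - ?l m i))) =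
        (\<Sum>x\<in>(UNIV :: ('a ^ 'n) set). \<Prod>i\<in>UNIV. (x $ i) ^ (?l k i + (?N - ?l m i)))"
      by (simp add: power_add prod.distrib)
    also have "\<dots> = (\<Prod>i\<in>UNIV. if ?l k i = ?l m i then - 1 else (0 :: 'a))"
      unfolding sum_vec_prod[where g = "\<lambda>i c. c ^ (?l k i + (?N - ?l m i))"]
      by (intro prod.cong refl sum_power_shifted small that m)
    also have "\<dots> = (if k = m then (- 1) ^ CARD('n) else 0)"
      by (auto simp: poly_mapping_eq_iff fun_eq_iff)
    finally show ?thesis .
  qed
  have "0 = (\<Sum>x\<in>UNIV. mpoly_eval F x * (\<Prod>i\<in>UNIV. x $ i ^ (?N - ?l m i)))"
    by (simp add: zero)
  also have "\<dots> = (\<Sum>k\<in>?K. ?l F k * (\<Sum>x\<in>UNIV. (\<Prod>i\<in>UNIV. x $ i ^ ?l k i) * (\<Prod>i\<in>UNIV. x $ i ^ (?N - ?l m i))))"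
    by (simp add: mpoly_eval_def sum_distrib_right sum_distrib_left mult.assoc) (rule sum.swap)
  also have "\<dots> = (\<Sum>k\<in>?K. if k = m then ?l F m * (- 1) ^ CARD('n) else 0)"
    by (intro sum.cong refl) (subst mono, assumption, simp)
  also have "\<dots> = ?l F m * (- 1) ^ CARD('n)"
    using m by simp
  finally show False
    using m by (simp add: in_keys_iff)
qed

lemma form_mpoly_eval:
  assumes "homogeneous_mpoly d F"
  shows "form d (mpoly_eval F)"
proof -
  have "form d (\<lambda>x. \<Prod>i\<in>UNIV. x $ i ^ Poly_Mapping.lookup m i)"
    if "m \<in> Poly_Mapping.keys F" for m
  proof -
    have "form (\<Sum>i\<in>UNIV. Poly_Mapping.lookup m i * 1) (\<lambda>x. \<Prod>i\<in>UNIV. x $ i ^ Poly_Mapping.lookup m i)"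
      by (intro form_prod form_power form_linear linear_funI) simp_all
    moreover have "(\<Sum>i\<in>UNIV. Poly_Mapping.lookup m i * 1) = d"
      using assms that by (simp add: homogeneous_mpoly_def)
    ultimately show ?thesis
      by (simp only:)
  qed
  then have "form d (\<lambda>x. \<Sum>m\<in>Poly_Mapping.keys F.
      Poly_Mapping.lookup F m * (\<Prod>i\<in>UNIV. x $ i ^ Poly_Mapping.lookup m i))"
    by (intro form_sum form_smult)
  then show ?thesis
    unfolding mpoly_eval_def[abs_def] .
qed

section \<open>Hermitian forms in four variables\<close>

definition indep :: "'a::field ^ 'n::finite \<Rightarrow> 'a ^ 'n \<Rightarrow> bool" where
  "indep x y \<longleftrightarrow> (\<forall>a b. a *s x + b *s y = 0 \<longrightarrow> a = 0 \<and> b = 0)"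

locale hermitian_space =
  fixes q :: nat and A :: "'a :: {field, finite} ^ 4 ^ 4"
  assumes primepow: "primepow q" and q3: "q \<ge> 3" and card: "CARD('a) = q ^ 2"
    and invertible: "invertible A" and hermitian: "transpose A = power_mat A q"
begin

lemmas frobenius_add = frobenius_add[OF primepow card]
lemmas frobenius_frobenius [simp] = frobenius_frobenius[OF primepow q3 card]
lemmas card_trace_fibre = card_trace_fibre[OF primepow q3 card]
lemmas norm_surj = norm_surj[OF primepow q3 card]

lemma q_pos [simp]: "q > 0"
  using q3 by simp

lemma frobenius_0 [simp]: "(0 :: 'a) ^ q = 0"
  by simp

lemma frobenius_minus: "(- x :: 'a) ^ q = - (x ^ q)"
  using frobenius_add[of x "- x"] by (simp add: eq_neg_iff_add_eq_0 add.commute)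

lemma frobenius_diff: "(x - y :: 'a) ^ q = x ^ q - y ^ q"
  using frobenius_add[of x "- y"] by (simp add: frobenius_minus)

lemma frobenius_sum: "(\<Sum>i\<in>S. f i :: 'a) ^ q = (\<Sum>i\<in>S. f i ^ q)"
  by (induction S rule: infinite_finite_induct) (simp_all add: frobenius_add)

definition herm :: "'a ^ 4 \<Rightarrow> 'a ^ 4 \<Rightarrow> 'a" where
  "herm x y = (\<Sum>i\<in>UNIV. x $ i * (A *v power_vec y q) $ i)"

lemma herm_self: "herm x x = hermitian_form q A x"
  by (simp add: herm_def hermitian_form_def)

lemma herm_expand: "herm x y = (\<Sum>i\<in>UNIV. \<Sum>j\<in>UNIV. x $ i * (A $ i $ j * y $ j ^ q))"
  by (simp add: herm_def matrix_vector_mult_def power_vec_def sum_distrib_left)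

lemma herm_swap: "herm x y ^ q = herm y x"
proof -
  have A: "A $ i $ j ^ q = A $ j $ i" for i j
    using arg_cong[OF hermitian, of "\<lambda>M. M $ i $ j"] by (simp add: power_mat_def transpose_def)
  have "herm x y ^ q = (\<Sum>i\<in>UNIV. \<Sum>j\<in>UNIV. x $ i ^ q * (A $ j $ i * y $ j))"
    by (simp add: herm_expand frobenius_sum power_mult_distrib A)
  also have "\<dots> = (\<Sum>j\<in>UNIV. \<Sum>i\<in>UNIV. x $ i ^ q * (A $ j $ i * y $ j))"
    by (rule sum.swap)
  also have "\<dots> = herm y x"
    by (simp add: herm_expand mult_ac)
  finally show ?thesis .
qed

lemma herm_add_left: "herm (x + y) z = herm x z + herm y z"
  by (simp add: herm_def distrib_right sum.distrib)

lemma herm_scale_left: "herm (c *s x) z = c * herm x z"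
  by (simp add: herm_def sum_distrib_left mult.assoc)

lemma linear_fun_herm: "linear_fun (\<lambda>x. herm x z)"
  by (rule linear_funI) (rule herm_add_left herm_scale_left)+

lemmas herm_left = linear_funD[OF linear_fun_herm]

lemma herm_add_right: "herm z (x + y) = herm z x + herm z y"
  by (metis herm_swap herm_add_left frobenius_add)

lemma herm_scale_right: "herm z (c *s x) = c ^ q * herm z x"
  by (metis herm_swap herm_scale_left power_mult_distrib)

lemma herm_diff_right: "herm z (x - y) = herm z x - herm z y"
  by (metis herm_swap herm_left(3) frobenius_diff)

lemmas herm_simps = herm_left herm_add_right herm_scale_right herm_diff_right

lemma herm_eq_0_swap: "herm x y = 0 \<longleftrightarrow> herm y x = 0"
  by (metis herm_swap frobenius_0)

lemma herm_self_frobenius: "herm x x ^ q = herm x x"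
  by (rule herm_swap)

lemma herm_nondegenerate:
  assumes "\<And>x. herm x y = 0"
  shows "y = 0"
proof -
  have "(A *v power_vec y q) $ i = 0" for i
  proof -
    have "herm (axis i 1) y = (\<Sum>j\<in>UNIV. if j = i then (A *v power_vec y q) $ j else 0)"
      unfolding herm_def by (intro sum.cong) (auto simp: axis_def)
    then show ?thesis
      using assms by simp
  qed
  then have Ay: "A *v power_vec y q = 0"
    by (simp add: vec_eq_iff)
  obtain B where "B ** A = mat 1"
    using invertible by (auto simp: invertible_def)
  then have "power_vec y q = B *v (A *v power_vec y q)"
    by (simp add: matrix_vector_mul_assoc)
  then have "power_vec y q = 0"
    using Ay by simp
  then show ?thesis
    by (simp add: vec_eq_iff power_vec_def)
qed

lemma ex_herm_eq_1:
  assumes "y \<noteq> 0"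
  shows "\<exists>x. herm x y = 1"
proof -
  obtain x where "herm x y \<noteq> 0"
    using herm_nondegenerate assms by blast
  then have "herm ((1 / herm x y) *s x) y = 1"
    by (simp add: herm_simps)
  then show ?thesis
    by blast
qed

text \<open>
  If \<open>u\<close> were orthogonal to all vectors that are orthogonal to \<open>v\<close>, then \<open>u\<close> would be a multiple
  of \<open>v\<close>, because the form is nondegenerate.
\<close>

lemma ex_dual:
  assumes "indep u v"
  shows "\<exists>z. herm z u = 1 \<and> herm z v = 0"
proof (rule ccontr)
  assume *: "\<not> ?thesis"
  have orth: "herm x u = 0" if "herm x v = 0" for x
  proof (rule ccontr)
    assume "herm x u \<noteq> 0"
    then have "herm ((1 / herm x u) *s x) u = 1 \<and> herm ((1 / herm x u) *s x) v = 0"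
      using that by (simp add: herm_simps)
    then show False
      using * by blast
  qed
  have "v \<noteq> 0"
    using assms unfolding indep_def
    by (metis add_0 vec.scale_zero_left vec.scale_zero_right zero_neq_one)
  then obtain y where y: "herm y v = 1"
    using ex_herm_eq_1 by blast
  have "herm x (u - (herm y u ^ q) *s v) = 0" for x
  proof -
    have "herm (x - herm x v *s y) u = 0"
      using y by (intro orth) (simp add: herm_simps)
    then show ?thesis
      by (simp add: herm_simps mult.commute)
  qed
  then have "u - (herm y u ^ q) *s v = 0"
    by (rule herm_nondegenerate)
  then have "1 *s u + (- (herm y u ^ q)) *s v = 0"
    by simp
  then show False
    using assms unfolding indep_def by (metis zero_neq_one)
qed

lemma ex_orthogonal: "\<exists>x. x \<noteq> 0 \<and> herm x a = 0 \<and> herm x b = 0 \<and> herm x c = 0"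
proof -
  let ?f = "\<lambda>x. (herm x a, herm x b, herm x c)"
  have "\<not> inj ?f"
  proof
    assume "inj ?f"
    then have "CARD('a ^ 4) \<le> CARD('a \<times> 'a \<times> 'a)"
      by (intro card_inj_on_le[of ?f]) auto
    then have "(q ^ 2) ^ 4 \<le> (q ^ 2) ^ 3"
      by (simp add: card power3_eq_cube mult.assoc)
    moreover have "(q ^ 2) ^ 3 < (q ^ 2) ^ 4"
      using q3 one_less_power[of q 2] by (intro power_strict_increasing) simp_all
    ultimately show False
      by linarith
  qed
  then obtain x y where "x \<noteq> y" "?f x = ?f y"
    by (auto simp: inj_def)
  then show ?thesis
    by (intro exI[of _ "x - y"]) (simp add: herm_simps)
qed

text \<open>
  Take orthogonal vectors \<open>e\<close> and \<open>f\<close> in the orthogonal space of \<open>a\<close> and \<open>b\<close>. If \<open>e\<close> is not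
  isotropic, then \<open>t e + f\<close> is, provided that the norm of \<open>t\<close> has a certain value in the
  subfield.
\<close>

lemma ex_isotropic: "\<exists>x. x \<noteq> 0 \<and> herm x x = 0 \<and> herm x a = 0 \<and> herm x b = 0"
proof -
  obtain e where e: "e \<noteq> 0" "herm e a = 0" "herm e b = 0"
    using ex_orthogonal by blast
  obtain f where f: "f \<noteq> 0" "herm f a = 0" "herm f b = 0" "herm f e = 0"
    using ex_orthogonal by blast
  show ?thesis
  proof (cases "herm e e = 0")
    case True
    then show ?thesis
      using e by blast
  next
    case False
    have "(- herm f f / herm e e) ^ q = - herm f f / herm e e"
      by (simp add: power_divide frobenius_minus herm_self_frobenius)
    then obtain t where t: "t ^ (q + 1) = - herm f f / herm e e"
      using norm_surj by blast
    have "herm (t *s e + f) (t *s e + f) = t ^ (q + 1) * herm e e + herm f f"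
      using f(4) herm_eq_0_swap[of f e] by (simp add: herm_simps mult_ac)
    also have "\<dots> = 0"
      using False t by simp
    finally have iso: "herm (t *s e + f) (t *s e + f) = 0" .
    have "t *s e + f \<noteq> 0"
    proof
      assume zero: "t *s e + f = 0"
      have "herm (t *s e + f) e = t * herm e e"
        using f(4) by (simp add: herm_simps)
      then have "t = 0"
        using zero False by (simp add: herm_simps)
      then show False
        using zero f(1) by simp
    qed
    then show ?thesis
      using iso e f by (intro exI[of _ "t *s e + f"]) (simp add: herm_simps)
  qed
qed

text \<open>
  The Gram matrix of a basis in which the form is \<open>a e\<^sup>q + e a\<^sup>q + b c\<^sup>q + c b\<^sup>q\<close> in the
  coordinates \<open>a, b, c, e\<close>.
\<close>

definition hyperbolic :: "'a ^ 4 \<Rightarrow> 'a ^ 4 \<Rightarrow> 'a ^ 4 \<Rightarrow> 'a ^ 4 \<Rightarrow> bool" where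
  "hyperbolic u v w z \<longleftrightarrow>
     herm u u = 0 \<and> herm v v = 0 \<and> herm w w = 0 \<and> herm z z = 0 \<and>
     herm u v = 0 \<and> herm u w = 0 \<and> herm v z = 0 \<and> herm w z = 0 \<and>
     herm u z = 1 \<and> herm v w = 1"

lemma ex_trace: 
  assumes "b ^ q = b"
  shows "\<exists>x :: 'a. x + x ^ q = b"
proof -
  have "card {x :: 'a. x + x ^ q = b} \<noteq> 0"
    using card_trace_fibre[OF assms] q3 by linarith
  then have "{x :: 'a. x + x ^ q = b} \<noteq> {}"
    by (metis card.empty)
  then show ?thesis
    by blast
qed

lemma indep_swap: "indep u v \<Longrightarrow> indep v u"
  unfolding indep_def by (metis add.commute)

text \<open>
  Vectors dual to \<open>v\<close> and \<open>u\<close> exist. They become isotropic when suitable multiples of \<open>v\<close> and \<open>u\<close>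
  are added, because the trace is surjective onto the subfield.
\<close>

lemma ex_hyperbolic_basis:
  assumes "indep u v" and uv: "herm u u = 0" "herm v v = 0" "herm u v = 0"
  shows "\<exists>w z. hyperbolic u v w z"
proof -
  have vu: "herm v u = 0"
    using uv(3) herm_eq_0_swap by blast
  have fix_iso: "\<exists>c. herm (x + c *s y) (x + c *s y) = 0" if "herm y y = 0" "herm x y = 1" for x y
  proof -
    have "herm y x = 1"
      using that(2) herm_swap[of x y] by simp
    moreover obtain c where "c + c ^ q = - herm x x"
      using ex_trace[of "- herm x x"] by (auto simp: frobenius_minus herm_self_frobenius)
    moreover have "herm (x + c *s y) (x + c *s y) =
        herm x x + c * herm y x + c ^ q * herm x y + c * c ^ q * herm y y"
      by (simp add: herm_simps algebra_simps)
    ultimately have "herm (x + c *s y) (x + c *s y) = 0"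
      using that by (simp add: add.assoc)
    then show ?thesis
      by blast
  qed
  obtain w0 where w0: "herm w0 v = 1" "herm w0 u = 0"
    using ex_dual[OF indep_swap[OF assms(1)]] by blast
  obtain c where c: "herm (w0 + c *s v) (w0 + c *s v) = 0"
    using fix_iso[OF uv(2) w0(1)] by blast
  define w where "w = w0 + c *s v"
  have w: "herm w w = 0" "herm w v = 1" "herm w u = 0"
    using c w0 uv vu by (simp_all add: w_def herm_simps)
  have w': "herm v w = 1" "herm u w = 0"
    using w(2) herm_swap[of w v] w(3) herm_eq_0_swap by auto
  obtain z0 where z0: "herm z0 u = 1" "herm z0 v = 0"
    using ex_dual[OF assms(1)] by blast
  define z1 where "z1 = z0 - herm z0 w *s v"
  have z1: "herm z1 u = 1" "herm z1 v = 0" "herm z1 w = 0"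
    using z0 uv vu w' by (simp_all add: z1_def herm_simps)
  obtain d where d: "herm (z1 + d *s u) (z1 + d *s u) = 0"
    using fix_iso[OF uv(1) z1(1)] by blast
  define z where "z = z1 + d *s u"
  have z: "herm z z = 0" "herm z u = 1" "herm z v = 0" "herm z w = 0"
    using d z1 uv w' by (simp_all add: z_def herm_simps)
  have "herm u z = 1" "herm v z = 0" "herm w z = 0"
    using z(2) herm_swap[of z u] z(3,4) herm_eq_0_swap by auto
  then show ?thesis
    using uv w w' z unfolding hyperbolic_def by blast
qed

lemma ex_isotropic_basis:
  assumes "u \<noteq> 0" and "herm u u = 0"
  shows "\<exists>v w z. hyperbolic u v w z"
proof -
  obtain y where y: "herm y u = 1"
    using ex_herm_eq_1[OF assms(1)] by blast
  obtain v where v: "v \<noteq> 0" "herm v v = 0" "herm v u = 0" "herm v y = 0"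
    using ex_isotropic by blast
  have "indep u v"
    unfolding indep_def
  proof (intro allI impI)
    fix a b
    assume ab: "a *s u + b *s v = 0"
    have "herm u y = 1"
      using y herm_swap[of y u] by simp
    then have "herm (a *s u + b *s v) y = a"
      using v by (simp add: herm_simps)
    then have "a = 0"
      using ab by (simp add: herm_simps)
    then show "a = 0 \<and> b = 0"
      using ab v(1) by simp
  qed
  then show ?thesis
    using ex_hyperbolic_basis assms(2) v herm_eq_0_swap by metis
qed

end

locale hyperbolic_basis = hermitian_space +
  fixes u v w z :: "'a ^ 4"
  assumes hyperbolic: "hyperbolic u v w z"
begin

lemma hyperbolic_simps [simp]:
  "herm u u = 0" "herm v v = 0" "herm w w = 0" "herm z z = 0"
  "herm u v = 0" "herm u w = 0" "herm v z = 0" "herm w z = 0" "herm u z = 1" "herm v w = 1"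
  "herm v u = 0" "herm w u = 0" "herm z v = 0" "herm z w = 0" "herm z u = 1" "herm w v = 1"
  using hyperbolic herm_swap[of u z] herm_swap[of v w] herm_eq_0_swap[of u v] herm_eq_0_swap[of u w]
    herm_eq_0_swap[of v z] herm_eq_0_swap[of w z] by (auto simp: hyperbolic_def)

text \<open>
  The Gram matrix makes the coordinate map injective, and both sides have \<open>CARD('a) ^ 4\<close>
  elements.
\<close>

lemma coordinates: "x = herm x z *s u + herm x w *s v + herm x v *s w + herm x u *s z"
proof -
  let ?f = "\<lambda>(a, b, c, e). a *s u + b *s v + c *s w + e *s z"
  have "inj ?f"
  proof (rule injI)
    fix s t
    assume eq: "?f s = ?f t"
    have "(herm (?f p) z, herm (?f p) w, herm (?f p) v, herm (?f p) u) = p" for p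
      by (cases p) (simp add: herm_simps)
    then show "s = t"
      using eq by metis
  qed
  then have "card (range ?f) = CARD('a \<times> 'a \<times> 'a \<times> 'a)"
    by (rule card_image)
  also have "\<dots> = CARD('a ^ 4)"
    by (simp add: power4_eq_xxxx mult.assoc)
  finally have "range ?f = UNIV"
    by (intro card_subset_eq) auto
  then have "x \<in> range ?f"
    by simp
  then obtain a b c e where x: "x = a *s u + b *s v + c *s w + e *s z"
    by auto
  show ?thesis
    by (simp add: x herm_simps)
qed

end

section \<open>Points of a Hermitian surface\<close>

definition proj_points :: "('a::field ^ 'n::finite) set \<Rightarrow> ('a ^ 'n) set set" where
  "proj_points C = {P \<in> proj_space. P \<subseteq> C}"

lemma proj_rel_image: "x \<noteq> 0 \<Longrightarrow> proj_rel `` {x} = {c *s x | c. c \<noteq> 0}"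
  by (auto simp: proj_rel_def)

lemma proj_points_cases:
  assumes "P \<in> proj_points C"
  obtains x where "x \<noteq> 0" and "x \<in> C" and "P = proj_rel `` {x}"
proof -
  have "P \<in> {x. x \<noteq> 0} // proj_rel"
    using assms by (simp add: proj_points_def proj_space_def)
  then obtain x where x': "P = proj_rel `` {x}" "x \<in> {x. x \<noteq> 0}"
    by (rule quotientE)
  then have x: "x \<noteq> 0" "P = proj_rel `` {x}"
    by simp_all
  have "x \<in> P"
    unfolding x(2) by (rule equiv_class_self[OF equiv_proj_rel x'(2)])
  moreover have "P \<subseteq> C"
    using assms by (simp add: proj_points_def)
  ultimately have "x \<in> C"
    by (rule rev_subsetD)
  then show ?thesis
    by (rule that[OF x(1) _ x(2)])
qed

lemma proj_rel_scale:
  assumes "x \<noteq> 0" and "c \<noteq> 0"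
  shows "proj_rel `` {c *s x} = proj_rel `` {x}"
proof -
  have "(c *s x, x) \<in> proj_rel"
    using assms by (auto simp: proj_rel_def vector_smult_assoc intro!: exI[of _ "inverse c"])
  then show ?thesis
    by (rule equiv_class_eq[OF equiv_proj_rel])
qed

lemma proj_points_subset_image:
  assumes "\<And>x. x \<in> C \<Longrightarrow> x \<noteq> 0 \<Longrightarrow> \<exists>c. c \<noteq> 0 \<and> c *s x \<in> N"
  shows "proj_points C \<subseteq> (\<lambda>x. proj_rel `` {x}) ` N"
proof
  fix P assume "P \<in> proj_points C"
  then obtain x where x: "x \<noteq> 0" "x \<in> C" "P = proj_rel `` {x}"
    by (rule proj_points_cases)
  then obtain c where "c \<noteq> 0" "c *s x \<in> N"
    using assms by blast
  then show "P \<in> (\<lambda>x. proj_rel `` {x}) ` N"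
    using x proj_rel_scale[of x c] by (intro image_eqI[of _ _ "c *s x"]) simp_all
qed

lemma card_proj_points_le:
  assumes "finite N" and "\<And>x. x \<in> C \<Longrightarrow> x \<noteq> 0 \<Longrightarrow> \<exists>c. c \<noteq> 0 \<and> c *s x \<in> N"
  shows "card (proj_points C) \<le> card N"
proof -
  have "proj_points C \<subseteq> (\<lambda>x. proj_rel `` {x}) ` N"
    by (rule proj_points_subset_image) (rule assms(2))
  then show ?thesis
    using assms(1) by (meson card_image_le card_mono finite_imageI le_trans)
qed

lemma card_proj_points_eq:
  assumes "finite N" and "\<And>x. x \<in> C \<Longrightarrow> x \<noteq> 0 \<Longrightarrow> \<exists>c. c \<noteq> 0 \<and> c *s x \<in> N"
    and cone: "\<And>c x. x \<in> C \<Longrightarrow> c *s x \<in> C"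
    and N: "\<And>x. x \<in> N \<Longrightarrow> x \<in> C \<and> x \<noteq> 0"
    and inj: "\<And>c x. x \<in> N \<Longrightarrow> c *s x \<in> N \<Longrightarrow> c *s x = x"
  shows "card (proj_points C) = card N"
proof -
  have "inj_on (\<lambda>x. proj_rel `` {x}) N"
  proof (rule inj_onI)
    fix x y assume xy: "x \<in> N" "y \<in> N" "proj_rel `` {x} = proj_rel `` {y}"
    have nz: "x \<noteq> 0" "y \<noteq> 0"
      using N xy by auto
    have "y \<in> proj_rel `` {x}"
      unfolding xy(3) by (rule equiv_class_self[OF equiv_proj_rel]) (simp add: nz)
    then obtain c where "y = c *s x"
      unfolding proj_rel_image[OF nz(1)] by auto
    then show "x = y"
      using inj[of x c] xy by simp
  qed
  then have "card N = card ((\<lambda>x. proj_rel `` {x}) ` N)"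
    by (simp add: card_image)
  also have "\<dots> \<le> card (proj_points C)"
  proof (rule card_mono)
    have "proj_points C \<subseteq> (\<lambda>x. proj_rel `` {x}) ` N"
      by (rule proj_points_subset_image) (rule assms(2))
    then show "finite (proj_points C)"
      using assms(1) finite_surj by blast
    show "(\<lambda>x. proj_rel `` {x}) ` N \<subseteq> proj_points C"
    proof clarify
      fix x assume x: "x \<in> N"
      then have "x \<noteq> 0" "x \<in> C"
        using N by auto
      moreover have "proj_rel `` {x} \<subseteq> C"
        using cone[OF \<open>x \<in> C\<close>] unfolding proj_rel_image[OF \<open>x \<noteq> 0\<close>] by blast
      moreover have "proj_rel `` {x} \<in> proj_space"
        unfolding proj_space_def using \<open>x \<noteq> 0\<close> by (intro quotientI) simp
      ultimately show "proj_rel `` {x} \<in> proj_points C"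
        by (simp only: proj_points_def mem_Collect_eq)
    qed
  qed
  finally show ?thesis
    using card_proj_points_le[OF assms(1,2)] by (intro antisym) auto
qed

lemma proj_points_Int: "proj_points (C \<inter> D) = proj_points C \<inter> proj_points D"
  by (auto simp: proj_points_def)

context hyperbolic_basis
begin

text \<open>
  The tangent plane at the point \<open>u + t v\<close> of the generator \<open>\<langle>u, v\<rangle>\<close> is
  spanned by the generator and \<open>w - t\<^sup>q z\<close>, and the tangent plane at \<open>v\<close> by the generator and
  \<open>z\<close>. The other generators in these planes correspond to the elements \<open>\<alpha>\<close> of trace 0; the
  last parameter of \<open>fin_point\<close> and \<open>inf_point\<close> is an affine parameter on such a generator,
  whose point at infinity is \<open>u + t v\<close> or \<open>v\<close>.
\<close>

definition trace_zero :: "'a set" where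
  "trace_zero = {\<alpha>. \<alpha> + \<alpha> ^ q = 0}"

lemma card_trace_zero: "card trace_zero = q"
  using card_trace_fibre[of 0] by (simp add: trace_zero_def)

definition fin_point :: "'a \<Rightarrow> 'a \<Rightarrow> 'a \<Rightarrow> 'a ^ 4" where
  "fin_point t \<alpha> a = a *s (u + t *s v) + \<alpha> *s v + (w - t ^ q *s z)"

definition inf_point :: "'a \<Rightarrow> 'a \<Rightarrow> 'a ^ 4" where
  "inf_point \<alpha> b = b *s v + \<alpha> *s u + z"

lemma herm_coordinates:
  "herm x x = herm x z * herm x u ^ q + herm x u * herm x z ^ q
    + (herm x w * herm x v ^ q + herm x v * herm x w ^ q)"
proof -
  have "herm x y = herm x z * herm u y + herm x w * herm v y + herm x v * herm w y
      + herm x u * herm z y" for y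
  proof -
    have "herm x y = herm (herm x z *s u + herm x w *s v + herm x v *s w + herm x u *s z) y"
      using coordinates[of x] by simp
    then show ?thesis
      by (simp add: herm_left)
  qed
  then have "herm x x = herm x z * herm u x + herm x w * herm v x + herm x v * herm w x
      + herm x u * herm z x" .
  also have "\<dots> = herm x z * herm x u ^ q + herm x w * herm x v ^ q + herm x v * herm x w ^ q
      + herm x u * herm x z ^ q"
    by (simp only: herm_swap)
  finally show ?thesis
    by (simp only: add_ac)
qed

lemma eq_of_coordinates:
  assumes "herm y z = a" and "herm y w = b" and "herm y v = c" and "herm y u = e"
  shows "y = a *s u + b *s v + c *s w + e *s z"
  using coordinates[of y] unfolding assms .

text \<open>
  The normalised vectors of the points of the surface, sorted by the tangent plane in
  which they lie.
\<close>

lemma isotropic_cases: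
  assumes "x \<noteq> 0" and "herm x x = 0"
  obtains c where "c \<noteq> 0" and "c *s x = v"
  | c t where "c \<noteq> 0" and "c *s x = u + t *s v"
  | c t \<alpha> a where "c \<noteq> 0" and "\<alpha> \<in> trace_zero" and "c *s x = fin_point t \<alpha> a"
  | c \<alpha> b where "c \<noteq> 0" and "\<alpha> \<in> trace_zero" and "c *s x = inf_point \<alpha> b"
proof -
  consider "herm x v \<noteq> 0" | "herm x v = 0" "herm x u \<noteq> 0"
    | "herm x v = 0" "herm x u = 0" "herm x z \<noteq> 0"
    | "herm x v = 0" "herm x u = 0" "herm x z = 0" "herm x w \<noteq> 0"
    using coordinates[of x] assms(1) by force
  then show ?thesis
  proof cases
    case 1
    define c where "c = 1 / herm x v"
    define y where "y = c *s x"
    \<comment> \<open>Since \<open>q\<close>-th powers are taken twice, \<open>t ^ q = - herm y u\<close>, which picks out the tangent plane.\<close>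
    define t where "t = - (herm y u ^ q)"
    define \<alpha> where "\<alpha> = herm y w - herm y z * t"
    have c: "c \<noteq> 0"
      using 1 by (simp add: c_def)
    have yv: "herm y v = 1"
      using 1 by (simp add: y_def c_def herm_simps)
    have t: "t ^ q = - herm y u"
      by (simp add: t_def frobenius_minus)
    have "herm y y = 0"
      using assms(2) by (simp add: y_def herm_simps)
    then have \<alpha>: "\<alpha> + \<alpha> ^ q = 0"
      using herm_coordinates[of y] yv t
      by (simp add: \<alpha>_def frobenius_diff power_mult_distrib) (simp add: t_def algebra_simps)
    have eq: "y = fin_point t \<alpha> (herm y z)"
    proof -
      have "y = herm y z *s u + (herm y z * t + \<alpha>) *s v + 1 *s w + (- (t ^ q)) *s z"
        using yv t by (intro eq_of_coordinates) (simp_all add: \<alpha>_def)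
      also have "\<dots> = fin_point t \<alpha> (herm y z)"
        by (simp add: fin_point_def vec.scale_left_distrib vec.scale_right_distrib
            vector_smult_assoc add_ac)
      finally show ?thesis .
    qed
    have "\<alpha> \<in> trace_zero"
      using \<alpha> by (simp add: trace_zero_def)
    then show ?thesis
      by (rule that(3)[OF c _ eq[unfolded y_def]])
  next
    case 2
    define c where "c = 1 / herm x u"
    define y where "y = c *s x"
    have c: "c \<noteq> 0"
      using 2 by (simp add: c_def)
    have y: "herm y u = 1" "herm y v = 0"
      using 2 by (simp_all add: y_def c_def herm_simps)
    have "herm y y = 0"
      using assms(2) by (simp add: y_def herm_simps)
    then have \<alpha>: "herm y z + herm y z ^ q = 0"
      using herm_coordinates[of y] y by (simp add: zero_power)
    have eq: "y = inf_point (herm y z) (herm y w)"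
    proof -
      have "y = herm y z *s u + herm y w *s v + 0 *s w + 1 *s z"
        using y by (intro eq_of_coordinates) simp_all
      also have "\<dots> = inf_point (herm y z) (herm y w)"
        by (simp add: inf_point_def add_ac)
      finally show ?thesis .
    qed
    have "herm y z \<in> trace_zero"
      using \<alpha> by (simp add: trace_zero_def)
    then show ?thesis
      unfolding y_def by (rule that(4)[OF c _ eq[unfolded y_def]])
  next
    case 3
    define c where "c = 1 / herm x z"
    have "c *s x = 1 *s u + (c * herm x w) *s v + 0 *s w + 0 *s z"
      using 3 by (intro eq_of_coordinates) (simp_all add: c_def herm_left)
    then have "c *s x = u + (c * herm x w) *s v"
      by simp
    moreover have "c \<noteq> 0"
      using 3 by (simp add: c_def)
    ultimately show ?thesis
      using that(2) by blast
  next
    case 4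
    define c where "c = 1 / herm x w"
    have "c *s x = 0 *s u + 1 *s v + 0 *s w + 0 *s z"
      using 4 by (intro eq_of_coordinates) (simp_all add: c_def herm_left)
    then have "c *s x = v"
      by simp
    moreover have "c \<noteq> 0"
      using 4 by (simp add: c_def)
    ultimately show ?thesis
      using that(1) by blast
  qed
qed

lemma herm_fin_point:
  "herm (fin_point t \<alpha> a) u = - (t ^ q)" "herm (fin_point t \<alpha> a) v = 1"
  "herm (fin_point t \<alpha> a) w = a * t + \<alpha>" "herm (fin_point t \<alpha> a) z = a"
  by (simp_all add: fin_point_def herm_simps)

lemma isotropic_fin_point:
  assumes "\<alpha> \<in> trace_zero"
  shows "herm (fin_point t \<alpha> a) (fin_point t \<alpha> a) = 0"
  using assms herm_coordinates[of "fin_point t \<alpha> a"]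
  by (simp add: herm_fin_point trace_zero_def frobenius_add power_mult_distrib frobenius_minus algebra_simps)

lemma herm_inf_point:
  "herm (inf_point \<alpha> b) u = 1" "herm (inf_point \<alpha> b) v = 0"
  "herm (inf_point \<alpha> b) w = b" "herm (inf_point \<alpha> b) z = \<alpha>"
  by (simp_all add: inf_point_def herm_simps)

lemma isotropic_inf_point:
  assumes "\<alpha> \<in> trace_zero"
  shows "herm (inf_point \<alpha> b) (inf_point \<alpha> b) = 0"
  using assms herm_coordinates[of "inf_point \<alpha> b"]
  by (simp add: herm_inf_point trace_zero_def zero_power)

lemma nonzero [simp]: "v \<noteq> 0" "u + t *s v \<noteq> 0" "fin_point t \<alpha> a \<noteq> 0"
proof -
  show "v \<noteq> 0"
    using hyperbolic_simps(10) by (metis herm_left(4) zero_neq_one)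
  have "herm (u + t *s v) z = 1"
    by (simp add: herm_simps)
  then show "u + t *s v \<noteq> 0"
    by (metis herm_left(4) zero_neq_one)
  show "fin_point t \<alpha> a \<noteq> 0"
    using herm_fin_point(2)[of t \<alpha> a] by (metis herm_left(4) zero_neq_one)
qed

lemma inj_line: "inj (\<lambda>t. u + t *s v)"
proof (rule injI)
  fix s t
  assume "u + s *s v = u + t *s v"
  from arg_cong[OF this, of "\<lambda>x. herm x w"] show "s = t"
    by (simp add: herm_left)
qed

lemma inj_fin_point: "inj (\<lambda>(\<alpha>, a). fin_point t \<alpha> a)"
proof (rule injI, clarify)
  fix \<alpha> a \<beta> b
  assume eq: "fin_point t \<alpha> a = fin_point t \<beta> b"
  have "a = b"
    using arg_cong[OF eq, of "\<lambda>x. herm x z"] by (simp add: herm_fin_point)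
  moreover have "a * t + \<alpha> = b * t + \<beta>"
    using arg_cong[OF eq, of "\<lambda>x. herm x w"] by (simp add: herm_fin_point)
  ultimately show "\<alpha> = \<beta> \<and> a = b"
    by simp
qed

lemma card_line: "card (insert v (range (\<lambda>t. u + t *s v))) = q ^ 2 + 1"
proof -
  have "v \<notin> range (\<lambda>t. u + t *s v)"
  proof
    assume "v \<in> range (\<lambda>t. u + t *s v)"
    then obtain t where "v = u + t *s v"
      by blast
    from arg_cong[OF this, of "\<lambda>x. herm x z"] show False
      by (simp add: herm_left)
  qed
  then show ?thesis
    using card_image[OF inj_line] card by simp
qed

lemma card_proj_points_line:
  "card (proj_points {x. herm x x = 0 \<and> herm x u = 0 \<and> herm x v = 0}) = q ^ 2 + 1"
proof -
  have "card (proj_points {x. herm x x = 0 \<and> herm x u = 0 \<and> herm x v = 0}) =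
      card (insert v (range (\<lambda>t. u + t *s v)))"
  proof (rule card_proj_points_eq)
    fix x assume x: "x \<in> {x. herm x x = 0 \<and> herm x u = 0 \<and> herm x v = 0}" "x \<noteq> 0"
    have "herm (c *s x) u = 0" "herm (c *s x) v = 0" for c
      using x(1) by (simp_all add: herm_simps)
    note cx = this
    have "herm x x = 0"
      using x(1) by simp
    with x(2) show "\<exists>c. c \<noteq> 0 \<and> c *s x \<in> insert v (range (\<lambda>t. u + t *s v))"
    proof (cases rule: isotropic_cases)
      case (3 c t \<alpha> a)
      then show ?thesis
        using cx(2)[of c] by (simp only: herm_fin_point zero_neq_one one_neq_zero)
    next
      case (4 c \<alpha> b)
      then show ?thesis
        using cx(1)[of c] by (simp only: herm_inf_point zero_neq_one one_neq_zero)
    qed blast+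
  next
    fix x c assume x: "x \<in> insert v (range (\<lambda>t. u + t *s v))"
      "c *s x \<in> insert v (range (\<lambda>t. u + t *s v))"
    have N: "herm y z = 1 \<or> herm y z = 0 \<and> herm y w = 1" if "y \<in> insert v (range (\<lambda>t. u + t *s v))" for y
      using that by (auto simp: herm_simps)
    have "c = 1"
      using N[OF x(1)] N[OF x(2)] by (auto simp: herm_simps)
    then show "c *s x = x"
      by simp
  qed (auto simp: herm_simps)
  then show ?thesis
    using card_line by simp
qed

lemma card_proj_points_tangent:
  "card (proj_points {x. herm x x = 0 \<and> herm x u = 0}) = q ^ 3 + q ^ 2 + 1"
proof -
  let ?L = "insert v (range (\<lambda>t. u + t *s v))"
  let ?T = "(\<lambda>(\<alpha>, a). fin_point 0 \<alpha> a) ` (trace_zero \<times> UNIV)"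
  have "card (proj_points {x. herm x x = 0 \<and> herm x u = 0}) = card (?L \<union> ?T)"
  proof (rule card_proj_points_eq)
    fix x assume x: "x \<in> {x. herm x x = 0 \<and> herm x u = 0}" "x \<noteq> 0"
    have cx: "herm (c *s x) u = 0" for c
      using x(1) by (simp add: herm_left)
    have "herm x x = 0"
      using x(1) by simp
    with x(2) show "\<exists>c. c \<noteq> 0 \<and> c *s x \<in> ?L \<union> ?T"
    proof (cases rule: isotropic_cases)
      case (3 c t \<alpha> a)
      then have "t = 0"
        using cx[of c] by (simp add: herm_fin_point)
      then have "c *s x \<in> ?T"
        unfolding 3(3) using 3(2) by auto
      then show ?thesis
        using 3(1) by blast
    next
      case (4 c \<alpha> b)
      then show ?thesis
        using cx[of c] by (simp only: herm_inf_point one_neq_zero)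
    qed blast+
  next
    fix x c assume x: "x \<in> ?L \<union> ?T" "c *s x \<in> ?L \<union> ?T"
    have N: "herm y v = 1 \<or> herm y v = 0 \<and> herm y z = 1 \<or> herm y v = 0 \<and> herm y z = 0 \<and> herm y w = 1"
      if "y \<in> ?L \<union> ?T" for y
      using that by (auto simp: herm_simps herm_fin_point)
    have "c = 1"
      using N[OF x(1)] N[OF x(2)] by (auto simp: herm_simps)
    then show "c *s x = x"
      by simp
  qed (auto simp: herm_simps herm_fin_point isotropic_fin_point)
  also have "\<dots> = card ?L + card ?T"
  proof (rule card_Un_disjoint)
    have "herm x v = 0" if "x \<in> ?L" for x
      using that by (auto simp: herm_simps)
    moreover have "herm x v = 1" if "x \<in> ?T" for x
      using that by (auto simp: herm_fin_point)
    ultimately show "?L \<inter> ?T = {}"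
      by (metis disjoint_iff zero_neq_one)
  qed simp_all
  also have "card ?T = card (trace_zero \<times> (UNIV :: 'a set))"
    using inj_fin_point[of 0] by (intro card_image) (auto simp: inj_on_def)
  also have "\<dots> = q ^ 3"
    by (simp add: card_cartesian_product card_trace_zero card power2_eq_square power3_eq_cube)
  finally show ?thesis
    using card_line by simp
qed

text \<open>
  Each of the \<open>q + 1\<close> generators through \<open>u\<close> meets the orthogonal space of \<open>p\<close> in exactly one
  point, since \<open>u\<close> is not orthogonal to \<open>p\<close>.
\<close>

lemma card_proj_points_tangent_Int:
  assumes "herm u p \<noteq> 0"
  shows "card (proj_points {x. herm x x = 0 \<and> herm x u = 0 \<and> herm x p = 0}) = q + 1"
proof -
  let ?k = "\<lambda>x. herm x p"
  define P where "P = (if ?k v = 0 then v else u + (- ?k u / ?k v) *s v)"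
  let ?T = "(\<lambda>\<alpha>. fin_point 0 \<alpha> (- ?k (fin_point 0 \<alpha> 0) / ?k u)) ` trace_zero"
  have k: "?k (fin_point 0 \<alpha> a) = a * ?k u + ?k (fin_point 0 \<alpha> 0)" for \<alpha> a
    by (simp add: fin_point_def herm_left)
  have P: "herm P u = 0" "herm P v = 0" "?k P = 0" "herm P P = 0"
    "herm P z = 1 \<or> herm P z = 0 \<and> herm P w = 1"
    by (auto simp: P_def herm_simps)
  have P0: "P \<noteq> 0"
    unfolding P_def by (split if_split) (intro conjI impI nonzero)
  have "card (proj_points {x. herm x x = 0 \<and> herm x u = 0 \<and> ?k x = 0}) = card (insert P ?T)"
  proof (rule card_proj_points_eq)
    fix x assume x: "x \<in> {x. herm x x = 0 \<and> herm x u = 0 \<and> ?k x = 0}" "x \<noteq> 0"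
    have cx: "herm (c *s x) u = 0" "?k (c *s x) = 0" for c
      using x(1) by (simp_all add: herm_left)
    have "herm x x = 0"
      using x(1) by simp
    with x(2) show "\<exists>c. c \<noteq> 0 \<and> c *s x \<in> insert P ?T"
    proof (cases rule: isotropic_cases)
      case (1 c)
      then have "?k v = 0"
        using cx(2)[of c] by simp
      then have "c *s x = P"
        using 1 by (simp add: P_def)
      then show ?thesis
        using 1 by blast
    next
      case (2 c t)
      have "?k u + t * ?k v = 0"
        using cx(2)[of c] 2 by (simp add: herm_left)
      then have tk: "t * ?k v = - ?k u"
        by (simp add: eq_neg_iff_add_eq_0 add.commute)
      then have "?k v \<noteq> 0"
        using assms by auto
      moreover from this have "t = - ?k u / ?k v"
        using nonzero_eq_divide_eq[of "?k v" t "- ?k u"] tk by blast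
      ultimately have "c *s x = P"
        using 2 by (simp add: P_def)
      then show ?thesis
        using 2 by blast
    next
      case (3 c t \<alpha> a)
      have "t = 0"
        using cx(1)[of c] 3 by (simp add: herm_fin_point)
      moreover have "a * ?k u + ?k (fin_point 0 \<alpha> 0) = 0"
        using cx(2)[of c] 3 \<open>t = 0\<close> k[of \<alpha> a] by simp
      then have "a * ?k u = - ?k (fin_point 0 \<alpha> 0)"
        by (simp add: eq_neg_iff_add_eq_0)
      then have "a = - ?k (fin_point 0 \<alpha> 0) / ?k u"
        using nonzero_eq_divide_eq[OF assms] by blast
      ultimately show ?thesis
        using 3 by (intro exI[of _ c]) blast
    next
      case (4 c \<alpha> b)
      then show ?thesis
        using cx(1)[of c] by (simp add: herm_inf_point)
    qed
  next
    fix x c assume x: "x \<in> insert P ?T" "c *s x \<in> insert P ?T"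
    have N: "herm y v = 1 \<or> herm y v = 0 \<and> herm y z = 1 \<or> herm y v = 0 \<and> herm y z = 0 \<and> herm y w = 1"
      if "y \<in> insert P ?T" for y
      using that P(2,5) by (elim insertE imageE) (simp_all only: herm_fin_point, blast+)
    have "c = 1"
      using N[OF x(1)] N[OF x(2)] by (auto simp: herm_left)
    then show "c *s x = x"
      by simp
  next
    fix x assume "x \<in> insert P ?T"
    then consider "x = P" | \<alpha> where "\<alpha> \<in> trace_zero" "x = fin_point 0 \<alpha> (- ?k (fin_point 0 \<alpha> 0) / ?k u)"
      by blast
    then show "x \<in> {x. herm x x = 0 \<and> herm x u = 0 \<and> ?k x = 0} \<and> x \<noteq> 0"
    proof cases
      case 1
      then show ?thesis
        using P(1,3,4) P0 by (simp only: mem_Collect_eq not_False_eq_True simp_thms)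
    next
      case 2
      have "?k x = 0"
        using assms unfolding 2(2) k[of \<alpha> "- ?k (fin_point 0 \<alpha> 0) / ?k u"] by simp
      moreover have "herm x u = 0"
        by (simp add: 2(2) herm_fin_point)
      moreover have "herm x x = 0" "x \<noteq> 0"
        using 2 by (simp_all add: isotropic_fin_point)
      ultimately show ?thesis
        by simp
    qed
  qed (auto simp: herm_simps)
  also have "\<dots> = card ?T + 1"
  proof -
    have "P \<notin> ?T"
    proof
      assume "P \<in> ?T"
      then obtain \<alpha> where "P = fin_point 0 \<alpha> (- ?k (fin_point 0 \<alpha> 0) / ?k u)"
        by (rule imageE)
      from arg_cong[OF this, of "\<lambda>x. herm x v"] show False
        by (simp only: P(2) herm_fin_point zero_neq_one)
    qed
    then show ?thesis
      by (rule card_insert_disjoint[OF finite, THEN trans]) (rule Suc_eq_plus1)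
  qed
  also have "card ?T = q"
  proof -
    have "inj_on (\<lambda>\<alpha>. fin_point 0 \<alpha> (- ?k (fin_point 0 \<alpha> 0) / ?k u)) trace_zero"
    proof (rule inj_onI)
      fix \<alpha> \<beta>
      assume "fin_point 0 \<alpha> (- ?k (fin_point 0 \<alpha> 0) / ?k u) = fin_point 0 \<beta> (- ?k (fin_point 0 \<beta> 0) / ?k u)"
      from arg_cong[OF this, of "\<lambda>x. herm x w"] show "\<alpha> = \<beta>"
        by (simp add: herm_fin_point)
    qed
    then show ?thesis
      by (simp add: card_image card_trace_zero)
  qed
  finally show ?thesis .
qed

end

section \<open>Forms on a plane\<close>

lemma card_form_zeros_on_line:
  fixes f :: "'a :: {field, finite} ^ 'n :: finite \<Rightarrow> 'a"
  assumes "form d f" and "f (x + s *s y) \<noteq> 0"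
  shows "card {t. f (x + t *s y) = 0} \<le> d"
proof -
  obtain p where p: "degree p \<le> d" "\<forall>t. f (x + t *s y) = poly p t"
    using form_on_line[OF assms(1), of y x] by (elim exE conjE)
  have "poly p s \<noteq> 0"
    using assms(2) unfolding p(2)[rule_format] .
  then have "p \<noteq> 0"
    by auto
  then have "card {t. poly p t = 0} \<le> d"
    using card_poly_roots_bound[of p] p(1) by linarith
  then show ?thesis
    unfolding p(2)[rule_format] .
qed

lemma form_zero_on_span:
  fixes f :: "'a :: {field, finite} ^ 'n :: finite \<Rightarrow> 'a"
  assumes f: "form d f" and d: "d < CARD('a)" and zero: "\<And>t. f (x + t *s y) = 0"
  shows "f (a *s x + b *s y) = 0"
proof (cases "a = 0")
  case True
  obtain p where p: "degree p \<le> d" "coeff p d = f y" "\<forall>t. f (x + t *s y) = poly p t"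
    using form_on_line[OF f, of y x] by (elim exE conjE)
  have "poly p t = poly 0 t" for t
    using p(3)[rule_format, of t] zero[of t] by simp
  then have "p = 0"
    using p(1) d by (intro poly_eqI_degree[where A = UNIV]) simp_all
  then have "f y = 0"
    using p(2) by simp
  then show ?thesis
    using True by (simp add: form_homogeneous[OF f])
next
  case False
  then have "a *s x + b *s y = a *s (x + (b / a) *s y)"
    by (simp add: vec_eq_iff field_simps)
  then show ?thesis
    by (simp only: form_homogeneous[OF f] zero mult_zero_right)
qed

text \<open>
  The hypothesis is about the affine points of a line in the plane. The point at infinity
  is covered too, because a form with \<open>CARD('a) - 1 > e\<close> zeros on a line vanishes on the
  line.
\<close>

lemma form_divide_by_line:
  fixes f :: "'a :: {field, finite} ^ 3 \<Rightarrow> 'a"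
  assumes f: "form e f" and e: "e < CARD('a) - 1" and zero: "\<And>x. f (vector [x, \<gamma>, 1]) = 0"
  shows "\<exists>G. form (e - 1) G \<and> (\<forall>y. f y = (y $ 2 - \<gamma> * y $ 3) * G y)"
proof -
  let ?h = "\<lambda>y :: 'a ^ 3. y $ 2 - \<gamma> * y $ 3"
  have h: "linear_fun ?h"
    by (rule linear_funI) (simp_all add: algebra_simps)
  have affine: "f (vector [x, r * \<gamma>, r]) = 0" if "r \<noteq> 0" for x r
  proof -
    have "vector [x, r * \<gamma>, r] = r *s (vector [x / r, \<gamma>, 1] :: 'a ^ 3)"
      using that by (simp add: vec_eq_iff forall_3 vector_3)
    then show ?thesis
      by (simp only: form_homogeneous[OF f] zero mult_zero_right)
  qed
  have "f (vector [x, 0, 0]) = 0" for x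
  proof (rule ccontr)
    assume *: "f (vector [x, 0, 0]) \<noteq> 0"
    have line: "vector [x, 0, 0] + r *s vector [0, \<gamma>, 1] = (vector [x, r * \<gamma>, r] :: 'a ^ 3)" for r
      by (simp add: vec_eq_iff forall_3 vector_3)
    have "card {r. f (vector [x, 0, 0] + r *s vector [0, \<gamma>, 1]) = 0} \<le> e"
    proof (rule card_form_zeros_on_line[OF f])
      show "f (vector [x, 0, 0] + 0 *s vector [0, \<gamma>, 1]) \<noteq> 0"
        using * by simp
    qed
    moreover have "UNIV - {0} \<subseteq> {r. f (vector [x, 0, 0] + r *s vector [0, \<gamma>, 1]) = 0}"
      unfolding line using affine by blast
    then have "card (UNIV - {0 :: 'a}) \<le> card {r. f (vector [x, 0, 0] + r *s vector [0, \<gamma>, 1]) = 0}"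
      by (intro card_mono) simp_all
    ultimately show False
      using e by (simp add: card_Diff_singleton)
  qed
  then have "f y = 0" if "?h y = 0" for y
  proof -
    have y: "y = vector [y $ 1, y $ 3 * \<gamma>, y $ 3]"
      using that by (simp add: vec_eq_iff forall_3 vector_3 mult.commute)
    show ?thesis
    proof (cases "y $ 3 = 0")
      case True
      have "y = vector [y $ 1, 0, 0]"
        using y unfolding True by simp
      then show ?thesis
        using \<open>\<And>x. f (vector [x, 0, 0]) = 0\<close> by metis
    next
      case False
      then show ?thesis
        using affine[OF False, of "y $ 1"] y by metis
    qed
  qed
  moreover have "?h (vector [0, 1, 0]) = 1"
    by (simp add: vector_3)
  ultimately show ?thesis
    using form_divide[OF f h] by blast
qed

lemma form_divide_by_lines:
  fixes f :: "'a :: {field, finite} ^ 3 \<Rightarrow> 'a"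
  assumes f: "form e f" and e: "e < CARD('a) - 1" and nonzero: "f y0 \<noteq> 0"
    and "finite B" and "\<And>\<gamma> x. \<gamma> \<in> B \<Longrightarrow> f (vector [x, \<gamma>, 1]) = 0"
  shows "card B \<le> e \<and> (\<exists>G. form (e - card B) G \<and> (\<forall>y. f y = (\<Prod>\<gamma>\<in>B. y $ 2 - \<gamma> * y $ 3) * G y))"
  using assms(4,5)
proof (induction B rule: finite_induct)
  case empty
  show ?case
    using f by auto
next
  case (insert \<gamma> B)
  have IH: "card B \<le> e" "\<exists>G. form (e - card B) G \<and> (\<forall>y. f y = (\<Prod>\<gamma>\<in>B. y $ 2 - \<gamma> * y $ 3) * G y)"
    using insert.IH insert.prems by blast+
  obtain G where G: "form (e - card B) G" "\<forall>y. f y = (\<Prod>\<gamma>\<in>B. y $ 2 - \<gamma> * y $ 3) * G y"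
    using IH(2) by (elim exE conjE)
  have zero: "G (vector [x, \<gamma>, 1]) = 0" for x
  proof -
    have "(\<Prod>\<beta>\<in>B. \<gamma> - \<beta>) * G (vector [x, \<gamma>, 1]) = 0"
      using G(2)[rule_format, of "vector [x, \<gamma>, 1]"] insert.prems[of \<gamma> x] by (simp add: vector_3)
    moreover have "(\<Prod>\<beta>\<in>B. \<gamma> - \<beta>) \<noteq> 0"
      using insert.hyps by auto
    ultimately show ?thesis
      by simp
  qed
  have "card B \<noteq> e"
  proof
    assume "card B = e"
    then have "form 0 G"
      using G(1) by simp
    then have "G y0 = 0"
      using form_zero_degree[of G y0 "vector [0, \<gamma>, 1]"] zero by simp
    then show False
      using nonzero G(2)[rule_format, of y0] by simp
  qed
  have e': "e - card B < CARD('a) - 1"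
    using e by simp
  obtain H where H: "form (e - card B - 1) H" "\<forall>y. G y = (y $ 2 - \<gamma> * y $ 3) * H y"
    using form_divide_by_line[OF G(1) e' zero] by (elim exE conjE)
  have "f y = (\<Prod>\<gamma>\<in>insert \<gamma> B. y $ 2 - \<gamma> * y $ 3) * H y" for y
    using insert.hyps G(2)[rule_format, of y] H(2)[rule_format, of y] by (simp add: mult_ac)
  moreover have "form (e - card (insert \<gamma> B)) H"
    using H(1) insert.hyps by simp
  ultimately show ?case
    using \<open>card B \<noteq> e\<close> IH(1) insert.hyps by auto
qed

text \<open>
  The affine lines with constant second coordinate all pass through the point \<open>(1, 0, 0)\<close>.
  If a form vanishes on \<open>b\<close> of them, their equations divide it. The cofactor has degree
  \<open>e - b\<close>, which bounds the zeros on any other line of the family. On the line at infinity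
  the equations become \<open>s\<close> each, which produces the factor \<open>s ^ b\<close>.
\<close>

lemma plane_form_count:
  fixes f :: "'a :: {field, finite} ^ 3 \<Rightarrow> 'a"
  assumes f: "form e f" and e: "e < CARD('a) - 1" and nonzero: "f y0 \<noteq> 0"
    and b: "b = card {\<alpha> \<in> S. \<forall>x. f (vector [x, \<alpha>, 1]) = 0}"
  shows "b \<le> e"
    and "card {(\<alpha>, x). \<alpha> \<in> S \<and> f (vector [x, \<alpha>, 1]) = 0} \<le> b * CARD('a) + card S * (e - b)"
    and "\<exists>G :: 'a ^ 3 \<Rightarrow> 'a. form (e - b) G \<and> (\<forall>x s. f (vector [x, s, 0]) = s ^ b * G (vector [x, s, 0]))"
proof -
  define B where "B = {\<alpha> \<in> S. \<forall>x. f (vector [x, \<alpha>, 1]) = 0}"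
  have bB: "b = card B" "B \<subseteq> S"
    using b by (auto simp: B_def)
  have "card B \<le> e \<and> (\<exists>G. form (e - card B) G \<and> (\<forall>y. f y = (\<Prod>\<gamma>\<in>B. y $ 2 - \<gamma> * y $ 3) * G y))"
    by (rule form_divide_by_lines[OF f e nonzero]) (simp_all add: B_def)
  then obtain G where be: "card B \<le> e" and G: "form (e - card B) G"
    "\<forall>y. f y = (\<Prod>\<gamma>\<in>B. y $ 2 - \<gamma> * y $ 3) * G y"
    by (elim exE conjE)
  show "b \<le> e"
    using be bB by simp
  have eq: "f (vector [x, s, 0]) = s ^ card B * G (vector [x, s, 0])" for x s
    using G(2)[rule_format, of "vector [x, s, 0]"] by (simp add: vector_3)
  show "\<exists>G :: 'a ^ 3 \<Rightarrow> 'a. form (e - b) G \<and> (\<forall>x s. f (vector [x, s, 0]) = s ^ b * G (vector [x, s, 0]))"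
    unfolding bB(1) by (intro exI[of _ G] conjI allI G(1) eq)
  have few: "card {x. f (vector [x, \<alpha>, 1]) = 0} \<le> e - b" if \<alpha>: "\<alpha> \<in> S - B" for \<alpha>
  proof -
    have fG: "f (vector [x, \<alpha>, 1]) = (\<Prod>\<gamma>\<in>B. \<alpha> - \<gamma>) * G (vector [x, \<alpha>, 1])" for x
      using G(2)[rule_format, of "vector [x, \<alpha>, 1]"] by (simp add: vector_3)
    have "(\<Prod>\<gamma>\<in>B. \<alpha> - \<gamma>) \<noteq> 0"
      using \<alpha> by auto
    then have eq: "f (vector [x, \<alpha>, 1]) = 0 \<longleftrightarrow> G (vector [x, \<alpha>, 1]) = 0" for x
      unfolding fG by simp
    obtain s where s: "f (vector [s, \<alpha>, 1]) \<noteq> 0"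
      using \<alpha> by (auto simp: B_def)
    have line: "vector [0, \<alpha>, 1] + x *s vector [1, 0, 0] = (vector [x, \<alpha>, 1] :: 'a ^ 3)" for x
      by (simp add: vec_eq_iff forall_3 vector_3)
    have "card {x. G (vector [0, \<alpha>, 1] + x *s vector [1, 0, 0]) = 0} \<le> e - card B"
      using card_form_zeros_on_line[OF G(1), of "vector [0, \<alpha>, 1]" s "vector [1, 0, 0]"] s
      unfolding line eq by blast
    then show ?thesis
      unfolding line eq bB(1) .
  qed
  have "card {(\<alpha>, x). \<alpha> \<in> S \<and> f (vector [x, \<alpha>, 1]) = 0} =
      card (SIGMA \<alpha>:S. {x. f (vector [x, \<alpha>, 1]) = 0})"
    by (rule arg_cong[where f = card]) auto
  also have "\<dots> = (\<Sum>\<alpha>\<in>S. card {x. f (vector [x, \<alpha>, 1]) = 0})"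
    by (simp add: card_SigmaI)
  also have "\<dots> = (\<Sum>\<alpha>\<in>B. card {x. f (vector [x, \<alpha>, 1]) = 0}) + (\<Sum>\<alpha>\<in>S - B. card {x. f (vector [x, \<alpha>, 1]) = 0})"
    using sum.subset_diff[OF bB(2)] by (simp add: add.commute)
  also have "\<dots> \<le> (\<Sum>\<alpha>\<in>B. CARD('a)) + (\<Sum>\<alpha>\<in>S - B. e - b)"
    by (intro add_mono sum_mono few card_mono) simp_all
  also have "\<dots> \<le> b * CARD('a) + card S * (e - b)"
    by (simp add: bB(1) card_mono)
  finally show "card {(\<alpha>, x). \<alpha> \<in> S \<and> f (vector [x, \<alpha>, 1]) = 0} \<le> b * CARD('a) + card S * (e - b)" .
qed

section \<open>Forms that vanish on a generator\<close>

context hyperbolic_basis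
begin

text \<open>
  The count along the generator \<open>\<langle>u, v\<rangle>\<close>: the points of the generator, and
  then the other points of the tangent planes at \<open>u + t v\<close> and at \<open>v\<close>.
\<close>

lemma card_proj_points_zeros_le:
  assumes f: "form d f"
  shows "card (proj_points {x. herm x x = 0 \<and> f x = 0}) \<le>
    card {x \<in> insert v (range (\<lambda>t. u + t *s v)). f x = 0}
    + (\<Sum>t\<in>UNIV. card {(\<alpha>, a). \<alpha> \<in> trace_zero \<and> f (fin_point t \<alpha> a) = 0})
    + card {(\<alpha>, b). \<alpha> \<in> trace_zero \<and> f (inf_point \<alpha> b) = 0}"
proof -
  let ?L = "{x \<in> insert v (range (\<lambda>t. u + t *s v)). f x = 0}"
  let ?F = "\<lambda>t. (\<lambda>(\<alpha>, a). fin_point t \<alpha> a) ` {(\<alpha>, a). \<alpha> \<in> trace_zero \<and> f (fin_point t \<alpha> a) = 0}"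
  let ?I = "(\<lambda>(\<alpha>, b). inf_point \<alpha> b) ` {(\<alpha>, b). \<alpha> \<in> trace_zero \<and> f (inf_point \<alpha> b) = 0}"
  have "card (proj_points {x. herm x x = 0 \<and> f x = 0}) \<le> card (?L \<union> (\<Union>t. ?F t) \<union> ?I)"
  proof (rule card_proj_points_le)
    fix x assume x: "x \<in> {x. herm x x = 0 \<and> f x = 0}" "x \<noteq> 0"
    then have fx: "f (c *s x) = 0" for c
      by (simp add: form_homogeneous[OF f])
    have "herm x x = 0"
      using x by simp
    with x(2) show "\<exists>c. c \<noteq> 0 \<and> c *s x \<in> ?L \<union> (\<Union>t. ?F t) \<union> ?I"
    proof (cases rule: isotropic_cases)
      case (1 c)
      then have "c *s x \<in> ?L"
        using fx[of c] by simp
      then show ?thesis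
        using 1(1) by blast
    next
      case (2 c t)
      then have "c *s x \<in> ?L"
        using fx[of c] by simp
      then show ?thesis
        using 2(1) by blast
    next
      case (3 c t \<alpha> a)
      then have "(\<alpha>, a) \<in> {(\<alpha>, a). \<alpha> \<in> trace_zero \<and> f (fin_point t \<alpha> a) = 0}"
        using fx[of c] by simp
      then have "(\<lambda>(\<alpha>, a). fin_point t \<alpha> a) (\<alpha>, a) \<in> ?F t"
        by (rule imageI)
      then have "c *s x \<in> ?F t"
        using 3 by simp
      then show ?thesis
        using 3(1) by blast
    next
      case (4 c \<alpha> b)
      then have "(\<alpha>, b) \<in> {(\<alpha>, b). \<alpha> \<in> trace_zero \<and> f (inf_point \<alpha> b) = 0}"
        using fx[of c] by simp
      then have "(\<lambda>(\<alpha>, b). inf_point \<alpha> b) (\<alpha>, b) \<in> ?I"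
        by (rule imageI)
      then have "c *s x \<in> ?I"
        using 4 by simp
      then show ?thesis
        using 4(1) by blast
    qed
  qed simp
  also have "\<dots> \<le> card ?L + card (\<Union>t. ?F t) + card ?I"
    by (intro order_trans[OF card_Un_le] add_right_mono card_Un_le)
  also have "\<dots> \<le> card ?L + (\<Sum>t\<in>UNIV. card (?F t)) + card ?I"
    by (intro add_left_mono add_right_mono card_UN_le) simp
  also have "\<dots> \<le> card ?L + (\<Sum>t\<in>UNIV. card {(\<alpha>, a). \<alpha> \<in> trace_zero \<and> f (fin_point t \<alpha> a) = 0})
      + card {(\<alpha>, b). \<alpha> \<in> trace_zero \<and> f (inf_point \<alpha> b) = 0}"
    by (intro add_mono sum_mono card_image_le order_refl) simp_all
  finally show ?thesis .
qed

text \<open>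
  The generator \<open>\<langle>u, v\<rangle>\<close> has the equations \<open>herm x v = 0\<close> and \<open>herm x u = 0\<close>. A
  form that can be written in this way vanishes on it with multiplicity at least \<open>\<mu>\<close>.
\<close>

abbreviation (input) line_expansion ::
    "nat \<Rightarrow> (nat \<Rightarrow> 'a ^ 4 \<Rightarrow> 'a) \<Rightarrow> 'a ^ 4 \<Rightarrow> 'a" where
  "line_expansion \<mu> E x \<equiv> (\<Sum>i\<le>\<mu>. herm x v ^ (\<mu> - i) * herm x u ^ i * E i x)"

text \<open>
  If all coefficients vanish on the generator, then each of them is a combination of its
  two equations, and the order of the expansion goes up by one.
\<close>

lemma line_expansion_step:
  assumes E: "\<And>i. i \<le> \<mu> \<Longrightarrow> form (Suc e) (E i)"
    and zero: "\<And>i a b. i \<le> \<mu> \<Longrightarrow> E i (a *s u + b *s v) = 0"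
  shows "\<exists>E'. (\<forall>i\<le>Suc \<mu>. form e (E' i)) \<and> (\<forall>x. line_expansion \<mu> E x = line_expansion (Suc \<mu>) E' x)"
proof -
  have "\<exists>G H. form e G \<and> form e H \<and> (\<forall>x. E i x = herm x v * G x + herm x u * H x)" if i: "i \<le> \<mu>" for i
  proof -
    have "\<exists>G H. form (Suc e - 1) G \<and> form (Suc e - 1) H \<and> (\<forall>x. E i x = herm x v * G x + herm x u * H x)"
    proof (rule form_divide_codim_2[OF E[OF i] linear_fun_herm linear_fun_herm, of w v u z])
      fix x assume "herm x v = 0" "herm x u = 0"
      then have "x = herm x z *s u + herm x w *s v + 0 *s w + 0 *s z"
        by (intro eq_of_coordinates refl)
      then have "x = herm x z *s u + herm x w *s v"
        by simp
      then show "E i x = 0"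
        using zero[OF i] by metis
    qed simp_all
    then show ?thesis
      by simp
  qed
  then have "\<forall>i. \<exists>G H. i \<le> \<mu> \<longrightarrow> form e G \<and> form e H \<and> (\<forall>x. E i x = herm x v * G x + herm x u * H x)"
    by blast
  then obtain G H where GH: "\<forall>i. i \<le> \<mu> \<longrightarrow> form e (G i) \<and> form e (H i) \<and>
      (\<forall>x. E i x = herm x v * G i x + herm x u * H i x)"
    by (subst (asm) choice_iff, elim exE, subst (asm) choice_iff, elim exE)
  define E' where "E' i x = (if i \<le> \<mu> then G i x else 0) + (if i = 0 then 0 else H (i - 1) x)" for i x
  have "form e (E' i)" if "i \<le> Suc \<mu>" for i
  proof -
    have GH': "form e (G j)" "form e (H j)" if "j \<le> \<mu>" for j
      using GH that by blast+
    have "form e (\<lambda>x. if i \<le> \<mu> then G i x else 0)"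
      by (cases "i \<le> \<mu>") (simp_all add: form_zero GH')
    moreover have "form e (\<lambda>x. if i = 0 then 0 else H (i - 1) x)"
      using that by (cases i) (simp_all add: form_zero GH')
    ultimately show ?thesis
      unfolding E'_def[abs_def] by (rule form.add)
  qed
  moreover have "line_expansion \<mu> E x = line_expansion (Suc \<mu>) E' x" for x
  proof -
    let ?c = "herm x v" and ?e = "herm x u"
    have "line_expansion (Suc \<mu>) E' x =
        (\<Sum>i\<le>Suc \<mu>. ?c ^ (Suc \<mu> - i) * ?e ^ i * (if i \<le> \<mu> then G i x else 0))
        + (\<Sum>i\<le>Suc \<mu>. ?c ^ (Suc \<mu> - i) * ?e ^ i * (if i = 0 then 0 else H (i - 1) x))"
      by (simp only: E'_def distrib_left sum.distrib)
    also have "(\<Sum>i\<le>Suc \<mu>. ?c ^ (Suc \<mu> - i) * ?e ^ i * (if i \<le> \<mu> then G i x else 0)) =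
        (\<Sum>i\<le>\<mu>. ?c ^ (\<mu> - i) * ?e ^ i * (?c * G i x))"
      by (simp add: Suc_diff_le mult_ac)
    also have "(\<Sum>i\<le>Suc \<mu>. ?c ^ (Suc \<mu> - i) * ?e ^ i * (if i = 0 then 0 else H (i - 1) x)) =
        (\<Sum>i\<le>\<mu>. ?c ^ (\<mu> - i) * ?e ^ i * (?e * H i x))"
      by (subst sum.atMost_Suc_shift) (simp add: mult_ac)
    also have "(\<Sum>i\<le>\<mu>. ?c ^ (\<mu> - i) * ?e ^ i * (?c * G i x)) + (\<Sum>i\<le>\<mu>. ?c ^ (\<mu> - i) * ?e ^ i * (?e * H i x)) =
        line_expansion \<mu> E x"
      unfolding sum.distrib[symmetric]
    proof (rule sum.cong[OF refl])
      fix i assume "i \<in> {..\<mu>}"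
      then have "E i x = ?c * G i x + ?e * H i x"
        using GH by auto
      then show "?c ^ (\<mu> - i) * ?e ^ i * (?c * G i x) + ?c ^ (\<mu> - i) * ?e ^ i * (?e * H i x) =
          ?c ^ (\<mu> - i) * ?e ^ i * E i x"
        by (simp only: distrib_left)
    qed
    finally show ?thesis
      by (rule sym)
  qed
  ultimately show ?thesis
    by blast
qed

text \<open>
  The step above can be repeated as long as all coefficients vanish on the generator. The
  order cannot exceed the degree, since coefficients of degree 0 that vanish somewhere are
  zero.
\<close>

lemma ex_line_expansion:
  assumes f: "form d f" and zero: "\<And>a b. f (a *s u + b *s v) = 0" and nonzero: "f x0 \<noteq> 0"
  shows "\<exists>\<mu> e E. \<mu> \<ge> 1 \<and> e + \<mu> = d \<and> (\<forall>i\<le>\<mu>. form e (E i)) \<and> (\<forall>x. f x = line_expansion \<mu> E x) \<and>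
    (\<exists>i\<le>\<mu>. \<exists>a b. E i (a *s u + b *s v) \<noteq> 0)"
proof (rule ccontr)
  assume none: "\<not> ?thesis"
  have "\<exists>E. (\<forall>i\<le>\<mu>. form (d - \<mu>) (E i)) \<and> (\<forall>x. f x = line_expansion \<mu> E x) \<and>
      (\<forall>i\<le>\<mu>. \<forall>a b. E i (a *s u + b *s v) = 0)" if "\<mu> \<le> d" for \<mu>
    using that
  proof (induction \<mu>)
    case 0
    show ?case
      using f zero by (intro exI[of _ "\<lambda>i. f"]) simp
  next
    case (Suc \<mu>)
    have "\<mu> \<le> d"
      using Suc.prems by simp
    obtain E where E: "\<forall>i\<le>\<mu>. form (d - \<mu>) (E i)" "\<forall>x. f x = line_expansion \<mu> E x"
        "\<forall>i\<le>\<mu>. \<forall>a b. E i (a *s u + b *s v) = 0"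
      using Suc.IH[OF \<open>\<mu> \<le> d\<close>] by (elim exE conjE)
    have "d - \<mu> = Suc (d - Suc \<mu>)"
      using Suc.prems by simp
    then have "\<exists>E'. (\<forall>i\<le>Suc \<mu>. form (d - Suc \<mu>) (E' i)) \<and>
        (\<forall>x. line_expansion \<mu> E x = line_expansion (Suc \<mu>) E' x)"
      using E(1,3) by (intro line_expansion_step) simp_all
    then obtain E' where E': "\<forall>i\<le>Suc \<mu>. form (d - Suc \<mu>) (E' i)"
        "\<forall>x. line_expansion \<mu> E x = line_expansion (Suc \<mu>) E' x"
      by (elim exE conjE)
    have f': "\<forall>x. f x = line_expansion (Suc \<mu>) E' x"
      using E(2) E'(2) by (blast intro: trans)
    have "\<forall>i\<le>Suc \<mu>. \<forall>a b. E' i (a *s u + b *s v) = 0"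
    proof (rule ccontr)
      assume "\<not> ?thesis"
      moreover have "Suc \<mu> \<ge> 1" "(d - Suc \<mu>) + Suc \<mu> = d"
        using Suc.prems by simp_all
      ultimately show False
        using none E'(1) f' by blast
    qed
    then show ?case
      using E'(1) f' by blast
  qed
  then obtain E where E: "\<forall>i\<le>d. form (d - d) (E i)" "\<forall>x. f x = line_expansion d E x"
      "\<forall>i\<le>d. \<forall>a b. E i (a *s u + b *s v) = 0"
    by blast
  have "E i x0 = 0" if "i \<le> d" for i
  proof -
    have "form 0 (E i)"
      using E(1) that by simp
    then have "E i x0 = E i (0 *s u + 0 *s v)"
      by (rule form_zero_degree)
    also have "\<dots> = 0"
      using E(3) that by blast
    finally show ?thesis .
  qed
  then have "f x0 = 0"
    unfolding E(2)[rule_format, of x0] by simp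
  then show False
    using nonzero by simp
qed


text \<open>
  This is the polynomial \<open>\<Sum> (- X\<^sup>q)\<^sup>i p\<^sub>i\<close>. When \<open>p\<^sub>i\<close> is the \<open>i\<close>-th coefficient of an
  expansion along the generator \<open>\<langle>u, v\<rangle>\<close>, restricted to \<open>u + X v\<close>, its value
  at \<open>t\<close> is the leading term of the form along the generator in the direction \<open>w - t\<^sup>q z\<close> of
  the tangent plane at \<open>u + t v\<close>.
\<close>

definition tangent_poly :: "nat \<Rightarrow> (nat \<Rightarrow> 'a poly) \<Rightarrow> 'a poly" where
  "tangent_poly \<mu> p = (\<Sum>i\<le>\<mu>. smult ((- 1) ^ i) (monom 1 q ^ i * p i))"

text \<open>
  The summands occupy disjoint ranges of exponents, so they cannot cancel.
\<close>

lemma coeff_tangent_poly: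
  assumes p: "\<And>i. i \<le> \<mu> \<Longrightarrow> degree (p i) < q" and "j \<le> \<mu>" and "k < q"
  shows "coeff (tangent_poly \<mu> p) (j * q + k) = (- 1) ^ j * coeff (p j) k"
proof -
  have "coeff (monom 1 q ^ i * p i) (j * q + k) = (if i = j then coeff (p j) k else 0)"
    if "i \<le> \<mu>" for i
  proof -
    have mon: "monom (1 :: 'a) q ^ i = monom 1 (i * q)"
      by (simp add: monom_power mult.commute)
    consider "i = j" | "i < j" | "j < i"
      by linarith
    then show ?thesis
    proof cases
      case 1
      then show ?thesis
        using mon by (simp add: coeff_monom_mult)
    next
      case 2
      then have "Suc i * q \<le> j * q"
        by (intro mult_right_mono) simp_all
      then have "degree (p i) < j * q + k - i * q"
        using p[OF that] by simp
      then show ?thesis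
        using 2 by (simp add: mon coeff_monom_mult coeff_eq_0)
    next
      case 3
      then have "Suc j * q \<le> i * q"
        by (intro mult_right_mono) simp_all
      then have "j * q + k < i * q"
        using \<open>k < q\<close> by simp
      then show ?thesis
        using 3 by (simp add: mon coeff_monom_mult)
    qed
  qed
  then have "coeff (tangent_poly \<mu> p) (j * q + k) =
      (\<Sum>i\<le>\<mu>. (- 1) ^ i * (if i = j then coeff (p j) k else 0))"
    by (simp add: tangent_poly_def coeff_sum)
  also have "\<dots> = (\<Sum>i\<le>\<mu>. if i = j then (- 1) ^ j * coeff (p j) k else 0)"
    by (intro sum.cong) auto
  also have "\<dots> = (- 1) ^ j * coeff (p j) k"
    using \<open>j \<le> \<mu>\<close> by simp
  finally show ?thesis .
qed

lemma tangent_poly_nonzero: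
  assumes "\<And>i. i \<le> \<mu> \<Longrightarrow> degree (p i) < q" and "j \<le> \<mu>" and "p j \<noteq> 0"
  shows "tangent_poly \<mu> p \<noteq> 0"
proof -
  have "coeff (tangent_poly \<mu> p) (j * q + degree (p j)) = (- 1) ^ j * lead_coeff (p j)"
    using assms by (intro coeff_tangent_poly) auto
  also have "\<dots> \<noteq> 0"
    using assms(3) by simp
  finally show ?thesis
    by auto
qed

text \<open>
  Only the last summand can reach the highest degrees, since the others end at least \<open>q\<close>
  places earlier and \<open>q\<close> is more than \<open>b\<close>.
\<close>

lemma degree_tangent_poly_le:
  assumes "\<And>i. i < \<mu> \<Longrightarrow> degree (p i) \<le> e" and "degree (p \<mu>) \<le> e - b" and "b \<le> e" and "e < q"
  shows "degree (tangent_poly \<mu> p) \<le> \<mu> * q + e - b"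
  unfolding tangent_poly_def
proof (rule degree_sum_le)
  fix i assume "i \<in> {..\<mu>}"
  have "degree (monom 1 q ^ i * p i) \<le> i * q + degree (p i)"
    using degree_mult_le[of "monom 1 q ^ i" "p i"] degree_monom_le[of "1 :: 'a" "i * q"]
    by (simp add: monom_power mult.commute)
  also have "\<dots> \<le> \<mu> * q + e - b"
  proof (cases "i = \<mu>")
    case True
    then show ?thesis
      using assms(2,3) by simp
  next
    case False
    then have "Suc i * q \<le> \<mu> * q"
      using \<open>i \<in> {..\<mu>}\<close> by (intro mult_right_mono) simp_all
    moreover have "degree (p i) \<le> e"
      using False \<open>i \<in> {..\<mu>}\<close> by (intro assms(1)) simp
    ultimately show ?thesis
      using assms(3,4) by simp
  qed
  finally show "degree (smult ((- 1) ^ i) (monom 1 q ^ i * p i)) \<le> \<mu> * q + e - b"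
    using degree_smult_le order_trans by blast
qed simp

lemma diff_dvd_power_diff: "(x :: 'b :: comm_ring_1) - y dvd x ^ n - y ^ n"
proof (induction n)
  case (Suc n)
  have "x ^ Suc n - y ^ Suc n = (x - y) * x ^ n + y * (x ^ n - y ^ n)"
    by (simp add: algebra_simps)
  then show ?case
    using Suc by simp
qed simp

text \<open>
  The polynomial \<open>X\<^sup>q - c\<^sup>q\<close> is the \<open>q\<close>-th power of \<open>X - c\<close>. So up to order \<open>q\<close> at \<open>c\<close> the powers of
  \<open>X\<^sup>q\<close> may be replaced by constants, which amounts to keeping the tangent plane at \<open>u + c v\<close>
  fixed.
\<close>

lemma tangent_poly_dvd:
  fixes c :: 'a
  assumes "k \<le> q"
    and "[:- c, 1:] ^ k dvd (\<Sum>i\<le>\<mu>. smult ((- (c ^ q)) ^ i) (p i))"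
  shows "[:- c, 1:] ^ k dvd tangent_poly \<mu> p"
proof -
  have frob: "[:- c, 1:] ^ q = monom 1 q - [:c ^ q:]"
  proof (rule poly_eqI_degree[where A = UNIV])
    show "poly ([:- c, 1:] ^ q) t = poly (monom 1 q - [:c ^ q:]) t" for t
      using frobenius_diff[of t c] by (simp add: poly_monom algebra_simps)
    have "q < q ^ 2"
      using q3 by (simp add: power2_eq_square)
    moreover have "degree (monom 1 q - [:c ^ q:] :: 'a poly) \<le> q"
      by (intro degree_diff_le degree_monom_le) simp
    ultimately show "degree ([:- c, 1:] ^ q) < card (UNIV :: 'a set)"
      "degree (monom 1 q - [:c ^ q:]) < card (UNIV :: 'a set)"
      using card by (simp_all add: degree_linear_power)
  qed
  have "tangent_poly \<mu> p - (\<Sum>i\<le>\<mu>. smult ((- (c ^ q)) ^ i) (p i)) =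
      (\<Sum>i\<le>\<mu>. smult ((- 1) ^ i) ((monom 1 q ^ i - [:c ^ q:] ^ i) * p i))"
    unfolding tangent_poly_def sum_subtractf[symmetric]
  proof (rule sum.cong[OF refl])
    fix i
    have "[:c ^ q:] ^ i * p i = smult ((c ^ q) ^ i) (p i)"
      by (simp add: poly_const_pow)
    moreover have "(- (c ^ q)) ^ i = (- 1) ^ i * (c ^ q) ^ i"
      by (rule power_minus)
    ultimately show "smult ((- 1) ^ i) (monom 1 q ^ i * p i) - smult ((- (c ^ q)) ^ i) (p i) =
        smult ((- 1) ^ i) ((monom 1 q ^ i - [:c ^ q:] ^ i) * p i)"
      by (simp add: left_diff_distrib smult_diff_right)
  qed
  moreover have "[:- c, 1:] ^ k dvd (\<Sum>i\<le>\<mu>. smult ((- 1) ^ i) ((monom 1 q ^ i - [:c ^ q:] ^ i) * p i))"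
  proof (rule dvd_sum)
    fix i
    have "[:- c, 1:] ^ k dvd [:- c, 1:] ^ q"
      using assms(1) by (rule le_imp_power_dvd)
    also have "\<dots> dvd monom 1 q ^ i - [:c ^ q:] ^ i"
      unfolding frob by (rule diff_dvd_power_diff)
    finally show "[:- c, 1:] ^ k dvd smult ((- 1) ^ i) ((monom 1 q ^ i - [:c ^ q:] ^ i) * p i)"
      by (intro dvd_smult dvd_mult2)
  qed
  ultimately have "[:- c, 1:] ^ k dvd tangent_poly \<mu> p - (\<Sum>i\<le>\<mu>. smult ((- (c ^ q)) ^ i) (p i))"
    by (simp only:)
  then show ?thesis
    using assms(2) by (metis dvd_add diff_add_cancel)
qed

lemma sum_le_degree:
  fixes g :: "'a poly"
  assumes "g \<noteq> 0" and "\<And>t. [:- t, 1:] ^ b t dvd g"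
  shows "(\<Sum>t\<in>UNIV. b t) \<le> degree g"
proof -
  have b: "b t \<le> order t g" for t
    using assms by (simp add: order_divides)
  then have "(\<Sum>t\<in>UNIV. b t) \<le> (\<Sum>t\<in>UNIV. order t g)"
    by (intro sum_mono)
  also have "\<dots> = (\<Sum>t | poly g t = 0. order t g)"
    by (intro sum.mono_neutral_right) (auto simp: order_0I)
  also have "\<dots> \<le> degree g"
    using assms(1) by (rule sum_order_le_degree)
  finally show ?thesis .
qed


text \<open>
  Each plane contributes \<open>q e + (q\<^sup>2 - q) b\<close>, so only the sum of the multiplicities matters.
  For \<open>\<mu> > 1\<close> there are \<open>2 (\<mu> - 1) q\<^sup>2\<close> to spare.
\<close>

lemma generator_count_arith:
  fixes T B e \<mu> b' :: nat and b :: "'a \<Rightarrow> nat"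
  assumes T: "T \<le> (q ^ 2 + 1) + (\<Sum>t\<in>(UNIV :: 'a set). b t * q ^ 2 + q * (e - b t)) + (b' * q ^ 2 + q * (e - b'))"
    and b: "\<And>t. b t \<le> e" "b' \<le> e" and B: "(\<Sum>t\<in>UNIV. b t) + b' \<le> \<mu> * q + e" and "\<mu> \<ge> 1"
  shows "T + q ^ 2 \<le> (e + \<mu>) * q ^ 3 + (e + \<mu>) * q ^ 2 + 1"
proof -
  define B where "B = (\<Sum>t\<in>UNIV. b t) + b'"
  have one: "int (k * q ^ 2 + q * (e - k)) = int q * int e + (int q ^ 2 - int q) * int k" if k: "k \<le> e" for k
  proof -
    obtain m where "e = k + m"
      using le_Suc_ex[OF k] by blast
    then show ?thesis
      by (simp add: algebra_simps)
  qed
  have "int T \<le> int (q ^ 2 + 1) + (\<Sum>t\<in>(UNIV :: 'a set). int (b t * q ^ 2 + q * (e - b t))) + int (b' * q ^ 2 + q * (e - b'))"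
    using T by (simp only: of_nat_sum[symmetric] of_nat_add[symmetric] of_nat_le_iff)
  also have "\<dots> = int (q ^ 2 + 1) + (\<Sum>t\<in>(UNIV :: 'a set). int q * int e + (int q ^ 2 - int q) * int (b t))
      + (int q * int e + (int q ^ 2 - int q) * int b')"
    using b by (simp only: one)
  also have "(\<Sum>t\<in>(UNIV :: 'a set). int q * int e + (int q ^ 2 - int q) * int (b t)) =
      int q ^ 2 * (int q * int e) + (int q ^ 2 - int q) * int (\<Sum>t\<in>UNIV. b t)"
    by (simp add: sum.distrib card sum_distrib_left)
  also have "int (q ^ 2 + 1) + (int q ^ 2 * (int q * int e) + (int q ^ 2 - int q) * int (\<Sum>t\<in>UNIV. b t))
      + (int q * int e + (int q ^ 2 - int q) * int b') =
      int q ^ 2 + 1 + (int q ^ 2 + 1) * (int q * int e) + (int q ^ 2 - int q) * int B"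
    by (simp add: B_def algebra_simps)
  also have "\<dots> \<le> int q ^ 2 + 1 + (int q ^ 2 + 1) * (int q * int e) + (int q ^ 2 - int q) * (int \<mu> * int q + int e)"
  proof (intro add_left_mono mult_left_mono)
    show "int B \<le> int \<mu> * int q + int e"
      using B unfolding B_def by (simp only: of_nat_mult[symmetric] of_nat_add[symmetric] of_nat_le_iff)
    show "0 \<le> int q ^ 2 - int q"
      using q3 by (simp add: power2_eq_square)
  qed
  also have "\<dots> = (int e + int \<mu>) * int q ^ 3 + (int e + int \<mu>) * int q ^ 2 + 1 - int q ^ 2
      - 2 * (int \<mu> - 1) * int q ^ 2"
    by (simp add: algebra_simps power2_eq_square power3_eq_cube)
  also have "\<dots> \<le> (int e + int \<mu>) * int q ^ 3 + (int e + int \<mu>) * int q ^ 2 + 1 - int q ^ 2"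
    using \<open>\<mu> \<ge> 1\<close> by simp
  finally have "int (T + q ^ 2) \<le> int ((e + \<mu>) * q ^ 3 + (e + \<mu>) * q ^ 2 + 1)"
    by simp
  then show ?thesis
    by (simp only: of_nat_le_iff)
qed

text \<open>
  The numbers \<open>b t\<close> and \<open>b'\<close> count the generators, other than \<open>\<langle>u, v\<rangle>\<close>, on which
  \<open>f\<close> vanishes in the tangent planes at \<open>u + t v\<close> and at \<open>v\<close>. They are bounded by the
  multiplicities of the roots of one nonzero polynomial \<open>g\<close> of formal degree \<open>\<mu> q + e\<close>: the
  point \<open>v\<close> is the root at infinity, so \<open>b'\<close> shows up as a drop in the degree.
\<close>

lemma card_zeros_le_generator:
  assumes f: "form d f" and d: "d \<le> q" and zero: "\<And>a b. f (a *s u + b *s v) = 0"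
    and tangent: "\<And>P. P \<noteq> 0 \<Longrightarrow> herm P P = 0 \<Longrightarrow> \<exists>x. herm x P = 0 \<and> f x \<noteq> 0"
  shows "card (proj_points {x. herm x x = 0 \<and> f x = 0}) + q ^ 2 \<le> d * q ^ 3 + d * q ^ 2 + 1"
proof -
  obtain x0 where x0: "f x0 \<noteq> 0"
    using tangent[of v] by auto
  obtain \<mu> e E i0 a0 b0 where \<mu>: "\<mu> \<ge> 1" "e + \<mu> = d" and E: "\<forall>i\<le>\<mu>. form e (E i)"
    and fE: "\<forall>x. f x = line_expansion \<mu> E x" and E0: "i0 \<le> \<mu>" "E i0 (a0 *s u + b0 *s v) \<noteq> 0"
    using ex_line_expansion[OF f zero x0] by (elim exE conjE)
  have eq: "e < q"
    using \<mu> d by simp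
  have q2: "q < q ^ 2"
    using q3 by (simp add: power2_eq_square)
  have e: "e < CARD('a) - 1"
    using eq q2 card by simp

  \<comment> \<open>On the tangent plane at \<open>u + t v\<close> the form is \<open>R t\<close> times the \<open>\<mu>\<close>-th power of an equation of the
    generator; on the tangent plane at \<open>v\<close> the form \<open>E \<mu>\<close> takes this role.\<close>
  define R where "R t x = (\<Sum>i\<le>\<mu>. (- (t ^ q)) ^ i * E i x)" for t x
  define pl where "pl t y = y $ 1 *s (u + t *s v) + y $ 2 *s v + y $ 3 *s (w - t ^ q *s z)"
    for t and y :: "'a ^ 3"
  define pl' where "pl' y = y $ 1 *s v + y $ 2 *s u + y $ 3 *s z" for y :: "'a ^ 3"
  have R: "form e (R t)" for t
    unfolding R_def[abs_def] using E by (intro form_sum form_smult) simp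
  have pl_lin: "pl t (x + y) = pl t x + pl t y" "pl t (c *s x) = c *s pl t x" for t x y c
    by (simp_all add: pl_def vec_eq_iff algebra_simps)
  have pl'_lin: "pl' (x + y) = pl' x + pl' y" "pl' (c *s x) = c *s pl' x" for x y c
    by (simp_all add: pl'_def vec_eq_iff algebra_simps)
  have Rpl: "form e (\<lambda>y. R t (pl t y))" for t
    by (rule form_compose[OF R]) (rule pl_lin)+
  have Epl: "form e (\<lambda>y. E \<mu> (pl' y))"
    by (rule form_compose) (use E in simp, (rule pl'_lin)+)

  have f_pl: "f (pl t y) = (y $ 3) ^ \<mu> * R t (pl t y)" for t y
  proof -
    have "herm (pl t y) v = y $ 3" "herm (pl t y) u = - (t ^ q) * y $ 3"
      by (simp_all add: pl_def herm_simps)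
    then have "f (pl t y) = (\<Sum>i\<le>\<mu>. (y $ 3) ^ (\<mu> - i) * (- (t ^ q) * y $ 3) ^ i * E i (pl t y))"
      using fE[rule_format, of "pl t y"] by (simp only:)
    also have "\<dots> = (\<Sum>i\<le>\<mu>. (y $ 3) ^ \<mu> * ((- (t ^ q)) ^ i * E i (pl t y)))"
    proof (rule sum.cong[OF refl])
      fix i assume "i \<in> {..\<mu>}"
      then have "(y $ 3) ^ \<mu> = (y $ 3) ^ (\<mu> - i) * (y $ 3) ^ i"
        by (simp flip: power_add)
      then show "(y $ 3) ^ (\<mu> - i) * (- (t ^ q) * y $ 3) ^ i * E i (pl t y) =
          (y $ 3) ^ \<mu> * ((- (t ^ q)) ^ i * E i (pl t y))"
        by (simp only: power_mult_distrib mult_ac)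
    qed
    finally show ?thesis
      by (simp only: R_def sum_distrib_left)
  qed
  have f_pl': "f (pl' y) = (y $ 3) ^ \<mu> * E \<mu> (pl' y)" for y
  proof -
    have "herm (pl' y) v = 0" "herm (pl' y) u = y $ 3"
      by (simp_all add: pl'_def herm_simps)
    then have "f (pl' y) = (\<Sum>i\<le>\<mu>. 0 ^ (\<mu> - i) * (y $ 3) ^ i * E i (pl' y))"
      using fE[rule_format, of "pl' y"] by (simp only:)
    also have "\<dots> = (\<Sum>i\<in>{\<mu>}. 0 ^ (\<mu> - i) * (y $ 3) ^ i * E i (pl' y))"
      by (rule sum.mono_neutral_right) auto
    finally show ?thesis
      by simp
  qed
  have fin: "fin_point t \<alpha> a = pl t (vector [a, \<alpha>, 1])" for t \<alpha> a
    by (simp add: fin_point_def pl_def vector_3)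
  have inf: "inf_point \<alpha> b = pl' (vector [b, \<alpha>, 1])" for \<alpha> b
    by (simp add: inf_point_def pl'_def vector_3)
  have f_fin: "f (fin_point t \<alpha> a) = R t (pl t (vector [a, \<alpha>, 1]))" for t \<alpha> a
    using f_pl[of t "vector [a, \<alpha>, 1]"] by (simp add: fin vector_3)
  have f_inf: "f (inf_point \<alpha> b) = E \<mu> (pl' (vector [b, \<alpha>, 1]))" for \<alpha> b
    using f_pl'[of "vector [b, \<alpha>, 1]"] by (simp add: inf vector_3)

  have "\<exists>y. R t (pl t y) \<noteq> 0" for t
  proof -
    obtain x where x: "herm x (u + t *s v) = 0" "f x \<noteq> 0"
      using tangent[of "u + t *s v"] by (auto simp: herm_simps)
    have xu: "herm x u = - (t ^ q) * herm x v"
      using x(1) by (simp add: herm_simps eq_neg_iff_add_eq_0)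
    have "x = herm x z *s u + herm x w *s v + herm x v *s w + (- (t ^ q) * herm x v) *s z"
      by (intro eq_of_coordinates refl xu)
    also have "\<dots> = pl t (vector [herm x z, herm x w - herm x z * t, herm x v])"
      by (simp add: pl_def vector_3 vec_eq_iff algebra_simps)
    finally have "f (pl t (vector [herm x z, herm x w - herm x z * t, herm x v])) \<noteq> 0"
      using x(2) by (rule subst)
    then have "R t (pl t (vector [herm x z, herm x w - herm x z * t, herm x v])) \<noteq> 0"
      unfolding f_pl by simp
    then show ?thesis
      by blast
  qed
  then obtain y where y: "\<And>t. R t (pl t (y t)) \<noteq> 0"
    by metis
  have "\<exists>y. E \<mu> (pl' y) \<noteq> 0"
  proof -
    obtain x where x: "herm x v = 0" "f x \<noteq> 0"
      using tangent[of v] by auto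
    have "x = herm x z *s u + herm x w *s v + 0 *s w + herm x u *s z"
      by (intro eq_of_coordinates refl x(1))
    also have "\<dots> = pl' (vector [herm x w, herm x z, herm x u])"
      by (simp add: pl'_def vector_3 add_ac)
    finally have "f (pl' (vector [herm x w, herm x z, herm x u])) \<noteq> 0"
      using x(2) by (rule subst)
    then have "E \<mu> (pl' (vector [herm x w, herm x z, herm x u])) \<noteq> 0"
      unfolding f_pl' by simp
    then show ?thesis
      by blast
  qed
  then obtain y' where y': "E \<mu> (pl' y') \<noteq> 0"
    by blast

  define b where "b t = card {\<alpha> \<in> trace_zero. \<forall>x. R t (pl t (vector [x, \<alpha>, 1])) = 0}" for t
  define b' where "b' = card {\<alpha> \<in> trace_zero. \<forall>x. E \<mu> (pl' (vector [x, \<alpha>, 1])) = 0}"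
  note fin_count = plane_form_count[OF Rpl e y b_def]
  note inf_count = plane_form_count[OF Epl e y' b'_def]

  have "\<exists>p. degree p \<le> e \<and> coeff p e = E i v \<and> (\<forall>t. E i (u + t *s v) = poly p t)" if "i \<le> \<mu>" for i
    using E that by (intro form_on_line) simp
  then obtain p where p: "\<And>i. i \<le> \<mu> \<Longrightarrow> degree (p i) \<le> e" "\<And>i. i \<le> \<mu> \<Longrightarrow> coeff (p i) e = E i v"
    "\<And>i t. i \<le> \<mu> \<Longrightarrow> E i (u + t *s v) = poly (p i) t"
    by metis
  define g where "g = tangent_poly \<mu> p"

  have ex_p: "\<exists>j\<le>\<mu>. p j \<noteq> 0"
  proof (rule ccontr)
    assume "\<not> ?thesis"
    then have p0: "p i = 0" if "i \<le> \<mu>" for i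
      using that by blast
    have "E i0 (a0 *s u + b0 *s v) = 0"
    proof (rule form_zero_on_span)
      show "form e (E i0)"
        using E E0(1) by simp
      show "E i0 (u + t *s v) = 0" for t
        using p(3)[OF E0(1)] p0[OF E0(1)] by simp
    qed (use e in simp)
    then show False
      using E0(2) by blast
  qed
  have deg_p: "degree (p i) < q" if "i \<le> \<mu>" for i
    using p(1)[OF that] eq by simp
  obtain j where "j \<le> \<mu>" "p j \<noteq> 0"
    using ex_p by blast
  with deg_p have g0: "g \<noteq> 0"
    unfolding g_def by (rule tangent_poly_nonzero)

  \<comment> \<open>In the tangent plane at \<open>v\<close>, the point \<open>u + t v\<close> has the coordinates \<open>(t, 1, 0)\<close>, so the factor
    \<open>s ^ b'\<close> is 1 and the cofactor of degree \<open>e - b'\<close> remains.\<close>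
  have "degree (p \<mu>) \<le> e - b'"
  proof -
    obtain G :: "'a ^ 3 \<Rightarrow> 'a" where G: "form (e - b') G"
        "\<forall>x s. E \<mu> (pl' (vector [x, s, 0])) = s ^ b' * G (vector [x, s, 0])"
      using inf_count(3) by (elim exE conjE)
    obtain r where r: "degree r \<le> e - b'" "\<forall>t. G (vector [0, 1, 0] + t *s vector [1, 0, 0]) = poly r t"
      using form_on_line[OF G(1), of "vector [1, 0, 0]" "vector [0, 1, 0]"] by (elim exE conjE)
    have "poly (p \<mu>) t = poly r t" for t
    proof -
      have "vector [0, 1, 0] + t *s vector [1, 0, 0] = (vector [t, 1, 0] :: 'a ^ 3)"
        by (simp add: vec_eq_iff forall_3 vector_3)
      then have "poly r t = G (vector [t, 1, 0])"
        using r(2)[rule_format, of t] by simp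
      also have "\<dots> = E \<mu> (pl' (vector [t, 1, 0]))"
        using G(2)[rule_format, of t 1] by simp
      also have "pl' (vector [t, 1, 0]) = u + t *s v"
        by (simp add: pl'_def vector_3 add.commute)
      also have "E \<mu> (u + t *s v) = poly (p \<mu>) t"
        by (rule p(3)) simp
      finally show ?thesis
        by (rule sym)
    qed
    then have "p \<mu> = r"
      using p(1)[of \<mu>] r(1) e by (intro poly_eqI_degree[where A = UNIV]) simp_all
    then show ?thesis
      using r(1) by simp
  qed
  then have deg: "degree g \<le> \<mu> * q + e - b'"
    unfolding g_def using p(1) inf_count(1) eq by (intro degree_tangent_poly_le) simp_all

  \<comment> \<open>The point \<open>u + t v\<close> has the coordinates \<open>(1, t - t0, 0)\<close> in the tangent plane at \<open>u + t0 v\<close>.\<close>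
  have "[:- t0, 1:] ^ b t0 dvd g" for t0
    unfolding g_def
  proof (rule tangent_poly_dvd)
    show "b t0 \<le> q"
      using fin_count(1)[of t0] eq by simp
    obtain G :: "'a ^ 3 \<Rightarrow> 'a" where G: "form (e - b t0) G"
        "\<forall>x s. R t0 (pl t0 (vector [x, s, 0])) = s ^ b t0 * G (vector [x, s, 0])"
      using fin_count(3)[of t0] by (elim exE conjE)
    obtain r where r: "degree r \<le> e - b t0" "\<forall>t. G (vector [1, 0, 0] + t *s vector [0, 1, 0]) = poly r t"
      using form_on_line[OF G(1), of "vector [0, 1, 0]" "vector [1, 0, 0]"] by (elim exE conjE)
    let ?r = "pcompose r [:- t0, 1:]"
    have "(\<Sum>i\<le>\<mu>. smult ((- (t0 ^ q)) ^ i) (p i)) = [:- t0, 1:] ^ b t0 * ?r"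
    proof (rule poly_eqI_degree[where A = UNIV])
      fix t
      have "vector [1, 0, 0] + (t - t0) *s vector [0, 1, 0] = (vector [1, t - t0, 0] :: 'a ^ 3)"
        by (simp add: vec_eq_iff forall_3 vector_3)
      then have rt: "poly ?r t = G (vector [1, t - t0, 0])"
        using r(2)[rule_format, of "t - t0"] by (simp add: poly_pcompose)
      have "poly (\<Sum>i\<le>\<mu>. smult ((- (t0 ^ q)) ^ i) (p i)) t = R t0 (u + t *s v)"
        by (simp add: poly_sum R_def p(3))
      also have "u + t *s v = pl t0 (vector [1, t - t0, 0])"
        by (simp add: pl_def vector_3 vec.scale_left_diff_distrib)
      also have "R t0 (pl t0 (vector [1, t - t0, 0])) = (t - t0) ^ b t0 * G (vector [1, t - t0, 0])"
        using G(2) by blast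
      also have "\<dots> = poly ([:- t0, 1:] ^ b t0 * ?r) t"
        by (simp add: rt)
      finally show "poly (\<Sum>i\<le>\<mu>. smult ((- (t0 ^ q)) ^ i) (p i)) t = poly ([:- t0, 1:] ^ b t0 * ?r) t" .
    next
      have "degree (\<Sum>i\<le>\<mu>. smult ((- (t0 ^ q)) ^ i) (p i)) \<le> e"
        using p(1) by (intro degree_sum_le) (auto intro: order_trans[OF degree_smult_le])
      then show "degree (\<Sum>i\<le>\<mu>. smult ((- (t0 ^ q)) ^ i) (p i)) < card (UNIV :: 'a set)"
        using e by simp
      have "degree ([:- t0, 1:] ^ b t0 * ?r) \<le> b t0 + (e - b t0)"
        using degree_mult_le[of "[:- t0, 1:] ^ b t0" ?r] r(1)
        by (simp add: degree_linear_power degree_pcompose)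
      then show "degree ([:- t0, 1:] ^ b t0 * ?r) < card (UNIV :: 'a set)"
        using e fin_count(1)[of t0] by simp
    qed
    then show "[:- t0, 1:] ^ b t0 dvd (\<Sum>i\<le>\<mu>. smult ((- (t0 ^ q)) ^ i) (p i))"
      by simp
  qed
  with g0 have "(\<Sum>t\<in>UNIV. b t) \<le> degree g"
    by (rule sum_le_degree)
  then have B: "(\<Sum>t\<in>UNIV. b t) + b' \<le> \<mu> * q + e"
    using deg inf_count(1) by simp

  have "card (proj_points {x. herm x x = 0 \<and> f x = 0}) \<le>
      card {x \<in> insert v (range (\<lambda>t. u + t *s v)). f x = 0}
      + (\<Sum>t\<in>UNIV. card {(\<alpha>, a). \<alpha> \<in> trace_zero \<and> f (fin_point t \<alpha> a) = 0})
      + card {(\<alpha>, b). \<alpha> \<in> trace_zero \<and> f (inf_point \<alpha> b) = 0}"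
    by (rule card_proj_points_zeros_le[OF f])
  also have "\<dots> \<le> (q ^ 2 + 1) + (\<Sum>t\<in>(UNIV :: 'a set). b t * q ^ 2 + q * (e - b t)) + (b' * q ^ 2 + q * (e - b'))"
  proof (intro add_mono sum_mono)
    have "card {x \<in> insert v (range (\<lambda>t. u + t *s v)). f x = 0} \<le> card (insert v (range (\<lambda>t. u + t *s v)))"
      by (rule card_mono) auto
    then show "card {x \<in> insert v (range (\<lambda>t. u + t *s v)). f x = 0} \<le> q ^ 2 + 1"
      using card_line by simp
    show "card {(\<alpha>, a). \<alpha> \<in> trace_zero \<and> f (fin_point t \<alpha> a) = 0} \<le> b t * q ^ 2 + q * (e - b t)" for t
      using fin_count(2)[of t] unfolding f_fin card card_trace_zero .
    show "card {(\<alpha>, b). \<alpha> \<in> trace_zero \<and> f (inf_point \<alpha> b) = 0} \<le> b' * q ^ 2 + q * (e - b')"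
      using inf_count(2) unfolding f_inf card card_trace_zero .
  qed
  finally have "card (proj_points {x. herm x x = 0 \<and> f x = 0}) + q ^ 2 \<le> (e + \<mu>) * q ^ 3 + (e + \<mu>) * q ^ 2 + 1"
    by (rule generator_count_arith) (use fin_count(1) inf_count(1) B \<mu>(1) in auto)
  then show ?thesis
    unfolding \<mu>(2) .
qed

end

section \<open>Forms that vanish on no tangent plane\<close>

lemma not_indep_scale:
  assumes "\<not> indep x y" and "x \<noteq> 0" and "y \<noteq> 0"
  shows "\<exists>c. c \<noteq> 0 \<and> y = c *s x"
proof -
  obtain a b where ab: "a *s x + b *s y = 0" "\<not> (a = 0 \<and> b = 0)"
    using assms(1) by (auto simp: indep_def)
  have "b \<noteq> 0"
    using ab assms(2) by auto
  have "b *s y = (- a) *s x"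
    using ab(1) by (simp add: eq_neg_iff_add_eq_0 add.commute)
  then have "(1 / b) *s (b *s y) = (1 / b) *s ((- a) *s x)"
    by simp
  then have y: "y = (- a / b) *s x"
    using \<open>b \<noteq> 0\<close> by (simp add: vector_smult_assoc)
  moreover have "- a / b \<noteq> 0"
    using y assms(3) by auto
  ultimately show ?thesis
    by blast
qed

lemma proj_points_Un:
  assumes "\<And>c x. x \<in> C \<Longrightarrow> c *s x \<in> C" and "\<And>c x. x \<in> D \<Longrightarrow> c *s x \<in> D"
  shows "proj_points (C \<union> D) = proj_points C \<union> proj_points D"
proof
  show "proj_points (C \<union> D) \<subseteq> proj_points C \<union> proj_points D"
  proof
    fix P assume P: "P \<in> proj_points (C \<union> D)"
    then obtain x where x: "x \<noteq> 0" "x \<in> C \<union> D" "P = proj_rel `` {x}"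
      by (rule proj_points_cases)
    have "P \<subseteq> C \<or> P \<subseteq> D"
      using x(2) assms unfolding x(3) proj_rel_image[OF x(1)] by blast
    then show "P \<in> proj_points C \<union> proj_points D"
      using P by (auto simp: proj_points_def)
  qed
qed (auto simp: proj_points_def)

lemma proj_points_mono: "C \<subseteq> D \<Longrightarrow> proj_points C \<subseteq> proj_points D"
  by (auto simp: proj_points_def)

lemma card_Un3:
  assumes "finite X" and "finite Y" and "finite Z"
  shows "card (X \<union> Y \<union> Z) + card (X \<inter> Y) + card (X \<inter> Z) + card (Y \<inter> Z) =
    card X + card Y + card Z + card (X \<inter> Y \<inter> Z)"
proof -
  have "card (X \<union> Y \<union> Z) + card ((X \<union> Y) \<inter> Z) = card (X \<union> Y) + card Z"
    using card_Un_Int[of "X \<union> Y" Z] assms by simp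
  moreover have "card (X \<union> Y) + card (X \<inter> Y) = card X + card Y"
    using card_Un_Int[of X Y] assms by simp
  moreover have "card ((X \<union> Y) \<inter> Z) + card (X \<inter> Y \<inter> Z) = card (X \<inter> Z) + card (Y \<inter> Z)"
  proof -
    have "(X \<union> Y) \<inter> Z = (X \<inter> Z) \<union> (Y \<inter> Z)" "X \<inter> Y \<inter> Z = (X \<inter> Z) \<inter> (Y \<inter> Z)"
      by blast+
    then show ?thesis
      using card_Un_Int[of "X \<inter> Z" "Y \<inter> Z"] assms by simp
  qed
  ultimately show ?thesis
    by linarith
qed

context hyperbolic_basis
begin

text \<open>
  The additive term \<open>d + 1\<close> stands for the points of \<open>\<langle>u, v\<rangle>\<close>, with \<open>v\<close> counted
  as a possible zero in any case. All other generators in the tangent planes contribute at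
  most \<open>d\<close> each.
\<close>

lemma card_zeros_le_no_generator:
  assumes f: "form d f" and d: "d < CARD('a)"
    and none: "\<And>x y. indep x y \<Longrightarrow> herm x x = 0 \<Longrightarrow> herm y y = 0 \<Longrightarrow> herm x y = 0 \<Longrightarrow>
      \<exists>t. f (x + t *s y) \<noteq> 0"
  shows "card (proj_points {x. herm x x = 0 \<and> f x = 0}) \<le> d + 1 + (q ^ 2 + 1) * (q * d)"
proof -
  have line: "card {t. f (x + t *s y) = 0} \<le> d"
    if "indep x y" "herm x x = 0" "herm y y = 0" "herm x y = 0" for x y
  proof -
    obtain t where "f (x + t *s y) \<noteq> 0"
      using none \<open>indep x y\<close> \<open>herm x x = 0\<close> \<open>herm y y = 0\<close> \<open>herm x y = 0\<close> by blast
    then show ?thesis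
      by (rule card_form_zeros_on_line[OF f])
  qed
  have family: "card {(\<alpha>, a). \<alpha> \<in> trace_zero \<and> f (h \<alpha> a) = 0} \<le> q * d"
    if h: "\<And>\<alpha> a. h \<alpha> a = x \<alpha> + a *s y"
      and xy: "\<And>\<alpha>. \<alpha> \<in> trace_zero \<Longrightarrow> indep (x \<alpha>) y \<and> herm (x \<alpha>) (x \<alpha>) = 0 \<and> herm y y = 0 \<and> herm (x \<alpha>) y = 0"
    for h x y
  proof -
    have "card {(\<alpha>, a). \<alpha> \<in> trace_zero \<and> f (h \<alpha> a) = 0} = card (SIGMA \<alpha>:trace_zero. {a. f (h \<alpha> a) = 0})"
      by (rule arg_cong[where f = card]) auto
    also have "\<dots> = (\<Sum>\<alpha>\<in>trace_zero. card {a. f (h \<alpha> a) = 0})"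
      by (simp add: card_SigmaI)
    also have "\<dots> \<le> (\<Sum>\<alpha>\<in>trace_zero. d)"
      unfolding h using xy by (intro sum_mono line) blast+
    finally show ?thesis
      by (simp add: card_trace_zero)
  qed
  have indep: "indep x y" if "herm x a = 1" "herm y a = 0" "herm y b = 1" for x y a b
    unfolding indep_def
  proof (intro allI impI)
    fix r s assume rs: "r *s x + s *s y = 0"
    have "r = 0"
      using arg_cong[OF rs, of "\<lambda>x. herm x a"] that by (simp add: herm_left)
    moreover have "r * herm x b + s = 0"
      using arg_cong[OF rs, of "\<lambda>x. herm x b"] that by (simp add: herm_left)
    ultimately show "r = 0 \<and> s = 0"
      by simp
  qed
  have fin: "card {(\<alpha>, a). \<alpha> \<in> trace_zero \<and> f (fin_point t \<alpha> a) = 0} \<le> q * d" for t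
  proof (rule family)
    show "fin_point t \<alpha> a = fin_point t \<alpha> 0 + a *s (u + t *s v)" for \<alpha> a
      by (simp add: fin_point_def add_ac)
    show "indep (fin_point t \<alpha> 0) (u + t *s v) \<and> herm (fin_point t \<alpha> 0) (fin_point t \<alpha> 0) = 0 \<and>
        herm (u + t *s v) (u + t *s v) = 0 \<and> herm (fin_point t \<alpha> 0) (u + t *s v) = 0" if "\<alpha> \<in> trace_zero" for \<alpha>
    proof (intro conjI)
      show "indep (fin_point t \<alpha> 0) (u + t *s v)"
        by (rule indep[of _ v _ z]) (simp_all add: herm_fin_point herm_left)
      show "herm (fin_point t \<alpha> 0) (u + t *s v) = 0"
        by (simp add: herm_simps herm_fin_point)
    qed (simp_all add: isotropic_fin_point that herm_simps)
  qed
  have inf: "card {(\<alpha>, b). \<alpha> \<in> trace_zero \<and> f (inf_point \<alpha> b) = 0} \<le> q * d"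
  proof (rule family)
    show "inf_point \<alpha> b = inf_point \<alpha> 0 + b *s v" for \<alpha> b
      by (simp add: inf_point_def add_ac)
    show "indep (inf_point \<alpha> 0) v \<and> herm (inf_point \<alpha> 0) (inf_point \<alpha> 0) = 0 \<and>
        herm v v = 0 \<and> herm (inf_point \<alpha> 0) v = 0" if "\<alpha> \<in> trace_zero" for \<alpha>
    proof (intro conjI)
      show "indep (inf_point \<alpha> 0) v"
        by (rule indep[of _ u _ w]) (simp_all add: herm_inf_point)
    qed (simp_all add: isotropic_inf_point that herm_inf_point)
  qed
  have "card {x \<in> insert v (range (\<lambda>t. u + t *s v)). f x = 0} \<le>
      card (insert v ((\<lambda>t. u + t *s v) ` {t. f (u + t *s v) = 0}))"
    by (rule card_mono) auto
  also have "\<dots> \<le> Suc (card ((\<lambda>t. u + t *s v) ` {t. f (u + t *s v) = 0}))"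
    by (rule card_insert_le_m1[THEN order_trans]) auto
  also have "\<dots> \<le> d + 1"
  proof -
    have "indep u v"
      by (rule indep[of _ z _ w]) simp_all
    then have "card {t. f (u + t *s v) = 0} \<le> d"
      by (rule line) simp_all
    then show ?thesis
      using card_image_le[of "{t. f (u + t *s v) = 0}" "\<lambda>t. u + t *s v"] by simp
  qed
  finally have L: "card {x \<in> insert v (range (\<lambda>t. u + t *s v)). f x = 0} \<le> d + 1" .
  have "card (proj_points {x. herm x x = 0 \<and> f x = 0}) \<le> d + 1 + (\<Sum>t\<in>(UNIV :: 'a set). q * d) + q * d"
    by (rule order_trans[OF card_proj_points_zeros_le[OF f]]) (intro add_mono sum_mono L fin inf)
  then show ?thesis
    by (simp add: card algebra_simps)
qed

end

context hermitian_space
begin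

definition zeros :: "('a ^ 4 \<Rightarrow> 'a) \<Rightarrow> ('a ^ 4) set" where
  "zeros f = {x. herm x x = 0 \<and> f x = 0}"

abbreviation (input) num_zeros :: "('a ^ 4 \<Rightarrow> 'a) \<Rightarrow> nat" where
  "num_zeros f \<equiv> card (proj_points (zeros f))"

lemma zeros_cone:
  assumes "form d f" and "x \<in> zeros f"
  shows "c *s x \<in> zeros f"
  using assms(2) by (simp add: zeros_def herm_simps form_homogeneous[OF assms(1)])

lemma num_zeros_le_no_tangent_plane:
  assumes f: "form d f" and d: "d \<le> q"
    and tangent: "\<And>P. P \<noteq> 0 \<Longrightarrow> herm P P = 0 \<Longrightarrow> \<exists>x. herm x P = 0 \<and> f x \<noteq> 0"
  shows "num_zeros f + q ^ 2 \<le> d * q ^ 3 + d * q ^ 2 + 1 \<or> num_zeros f \<le> d + 1 + (q ^ 2 + 1) * (q * d)"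
proof -
  have "q < q ^ 2"
    using q3 by (simp add: power2_eq_square)
  then have dq: "d < CARD('a)"
    using d card by simp
  show ?thesis
  proof (cases "\<exists>x y. indep x y \<and> herm x x = 0 \<and> herm y y = 0 \<and> herm x y = 0 \<and> (\<forall>t. f (x + t *s y) = 0)")
    case True
    then obtain u v where uv: "indep u v" "herm u u = 0" "herm v v = 0" "herm u v = 0"
        "\<forall>t. f (u + t *s v) = 0"
      by blast
    obtain w z where "hyperbolic u v w z"
      using ex_hyperbolic_basis[OF uv(1-4)] by blast
    then interpret hyperbolic_basis q A u v w z
      by unfold_locales
    have "f (a *s u + b *s v) = 0" for a b
      by (rule form_zero_on_span[OF f dq]) (rule uv(5)[rule_format])
    then show ?thesis
      using card_zeros_le_generator[OF f d _ tangent] unfolding zeros_def by blast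
  next
    case False
    obtain u where u: "u \<noteq> 0" "herm u u = 0"
      using ex_isotropic by blast
    obtain v w z where "hyperbolic u v w z"
      using ex_isotropic_basis[OF u] by blast
    then interpret hyperbolic_basis q A u v w z
      by unfold_locales
    have "num_zeros f \<le> d + 1 + (q ^ 2 + 1) * (q * d)"
      unfolding zeros_def by (rule card_zeros_le_no_generator[OF f dq]) (use False in blast)
    then show ?thesis
      by blast
  qed
qed

lemma tangent_plane_factor:
  assumes f: "form d f" and P: "P \<noteq> 0" and zero: "\<And>x. herm x P = 0 \<Longrightarrow> f x = 0"
  shows "\<exists>G. form (d - 1) G \<and> (\<forall>x. f x = herm x P * G x)"
proof -
  obtain e where "herm e P = 1"
    using ex_herm_eq_1[OF P] by blast
  then show ?thesis
    using form_divide[OF f linear_fun_herm _ zero] by blast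
qed

abbreviation (input) tangent_section :: "'a ^ 4 \<Rightarrow> ('a ^ 4) set set" where
  "tangent_section P \<equiv> proj_points (zeros (\<lambda>x. herm x P))"

lemma card_tangent_section:
  assumes "P \<noteq> 0" and "herm P P = 0"
  shows "card (tangent_section P) = q ^ 3 + q ^ 2 + 1"
proof -
  obtain v w z where "hyperbolic P v w z"
    using ex_isotropic_basis[OF assms] by blast
  then interpret hyperbolic_basis q A P v w z
    by unfold_locales
  show ?thesis
    using card_proj_points_tangent unfolding zeros_def .
qed

lemma card_tangent_section_Int:
  assumes "indep P Q" and "herm P P = 0" and "herm Q Q = 0"
  shows "card (tangent_section P \<inter> tangent_section Q) = q + 1 \<or> card (tangent_section P \<inter> tangent_section Q) = q ^ 2 + 1"
proof -
  have Int: "tangent_section P \<inter> tangent_section Q = proj_points {x. herm x x = 0 \<and> herm x P = 0 \<and> herm x Q = 0}"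
    unfolding zeros_def proj_points_Int[symmetric] by (rule arg_cong[where f = proj_points]) auto
  have "P \<noteq> 0"
    using assms(1) unfolding indep_def by (metis add_0 add.commute vec.scale_zero_left vec.scale_zero_right zero_neq_one)
  show ?thesis
  proof (cases "herm P Q = 0")
    case True
    obtain w z where "hyperbolic P Q w z"
      using ex_hyperbolic_basis[OF assms True] by blast
    then interpret hyperbolic_basis q A P Q w z
      by unfold_locales
    show ?thesis
      unfolding Int using card_proj_points_line by blast
  next
    case False
    obtain v w z where "hyperbolic P v w z"
      using ex_isotropic_basis[OF \<open>P \<noteq> 0\<close> assms(2)] by blast
    then interpret hyperbolic_basis q A P v w z
      by unfold_locales
    show ?thesis
      unfolding Int using card_proj_points_tangent_Int[OF False] by blast
  qed
qed

text \<open>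
  The space orthogonal to \<open>P\<close> and \<open>Q\<close> is two-dimensional, so the linear functional given by \<open>R\<close>
  is zero on it once it vanishes at two independent vectors. The dimension enters as a
  cardinality: vectors dual to \<open>P\<close> and \<open>Q\<close> together with \<open>x\<close>, \<open>y\<close> and \<open>s\<close> would be five independent
  vectors.
\<close>

lemma orthogonal_pair_dim:
  assumes PQ: "indep P Q" and xy: "indep x y"
    and x: "herm x P = 0" "herm x Q = 0" "herm x R = 0"
    and y: "herm y P = 0" "herm y Q = 0" "herm y R = 0"
    and s: "herm s P = 0" "herm s Q = 0"
  shows "herm s R = 0"
proof (rule ccontr)
  assume sR: "herm s R \<noteq> 0"
  obtain m where m: "herm m P = 1" "herm m Q = 0"
    using ex_dual[OF PQ] by blast
  obtain n where n: "herm n Q = 1" "herm n P = 0"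
    using ex_dual[OF indep_swap[OF PQ]] by blast
  let ?f = "\<lambda>(a, b, c, d, e). a *s m + b *s n + c *s x + d *s y + e *s s"
  have zero: "p = 0" if "?f p = 0" for p
  proof -
    obtain a b c d e where p: "p = (a, b, c, d, e)"
      by (cases p) blast
    have eq: "a *s m + b *s n + c *s x + d *s y + e *s s = 0"
      using that by (simp add: p)
    have ab: "a = 0" "b = 0"
      using arg_cong[OF eq, of "\<lambda>x. herm x P"] arg_cong[OF eq, of "\<lambda>x. herm x Q"]
      by (simp_all add: herm_left m n x y s)
    then have "e = 0"
      using arg_cong[OF eq, of "\<lambda>x. herm x R"] sR by (simp add: herm_left x y)
    then have "c *s x + d *s y = 0"
      using eq ab by simp
    then show ?thesis
      using xy ab \<open>e = 0\<close> by (simp add: indep_def p zero_prod_def)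
  qed
  have diff: "?f p - ?f r = ?f (p - r)" for p r
    by (cases p, cases r) (simp add: vec_eq_iff algebra_simps)
  have "inj ?f"
  proof (rule injI)
    fix p r assume "?f p = ?f r"
    then have "?f (p - r) = 0"
      using diff[of p r] by simp
    then show "p = r"
      using zero[of "p - r"] by simp
  qed
  then have "CARD('a \<times> 'a \<times> 'a \<times> 'a \<times> 'a) \<le> CARD('a ^ 4)"
    by (intro card_inj_on_le[of ?f]) auto
  then have "(q ^ 2) ^ 5 \<le> (q ^ 2) ^ 4"
    by (simp add: card power_numeral_reduce)
  moreover have "(q ^ 2) ^ 4 < (q ^ 2) ^ 5"
    using q3 one_less_power[of q 2] by (intro power_strict_increasing) simp_all
  ultimately show False
    by linarith
qed

lemma tangent_section_Int_cases:
  assumes "indep P Q"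
  shows "tangent_section P \<inter> tangent_section Q \<subseteq> tangent_section R \<or> card (tangent_section P \<inter> tangent_section Q \<inter> tangent_section R) \<le> 1"
proof (rule disjCI)
  assume "\<not> card (tangent_section P \<inter> tangent_section Q \<inter> tangent_section R) \<le> 1"
  then obtain X Y where XY: "X \<in> tangent_section P \<inter> tangent_section Q \<inter> tangent_section R" "Y \<in> tangent_section P \<inter> tangent_section Q \<inter> tangent_section R" "X \<noteq> Y"
    using card_le_Suc0_iff_eq[of "tangent_section P \<inter> tangent_section Q \<inter> tangent_section R"] by auto
  have Int: "tangent_section P \<inter> tangent_section Q \<inter> tangent_section R = proj_points
      (zeros (\<lambda>x. herm x P) \<inter> zeros (\<lambda>x. herm x Q) \<inter> zeros (\<lambda>x. herm x R))"
    by (simp only: proj_points_Int)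
  obtain x where x: "x \<noteq> 0" "x \<in> zeros (\<lambda>x. herm x P) \<inter> zeros (\<lambda>x. herm x Q) \<inter> zeros (\<lambda>x. herm x R)"
      "X = proj_rel `` {x}"
    using XY(1) unfolding Int by (rule proj_points_cases)
  obtain y where y: "y \<noteq> 0" "y \<in> zeros (\<lambda>x. herm x P) \<inter> zeros (\<lambda>x. herm x Q) \<inter> zeros (\<lambda>x. herm x R)"
      "Y = proj_rel `` {y}"
    using XY(2) unfolding Int by (rule proj_points_cases)
  have "indep x y"
  proof (rule ccontr)
    assume "\<not> indep x y"
    then obtain c where "c \<noteq> 0" "y = c *s x"
      using not_indep_scale x(1) y(1) by blast
    then show False
      using XY(3) x(1,3) y(3) proj_rel_scale[of x c] by simp
  qed
  have "zeros (\<lambda>x. herm x P) \<inter> zeros (\<lambda>x. herm x Q) \<subseteq> zeros (\<lambda>x. herm x R)"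
  proof
    fix s assume "s \<in> zeros (\<lambda>x. herm x P) \<inter> zeros (\<lambda>x. herm x Q)"
    then show "s \<in> zeros (\<lambda>x. herm x R)"
      using x(2) y(2) orthogonal_pair_dim[OF assms \<open>indep x y\<close>, of R s] by (simp add: zeros_def)
  qed
  then show "tangent_section P \<inter> tangent_section Q \<subseteq> tangent_section R"
    unfolding proj_points_Int[symmetric] by (rule proj_points_mono)
qed

end

section \<open>Cubic forms\<close>

context hermitian_space
begin

lemma zeros_mult: "zeros (\<lambda>x. f x * g x) = zeros f \<union> zeros g"
  by (auto simp: zeros_def)

lemma proj_points_zeros_mult:
  assumes "form d f" and "form e g"
  shows "proj_points (zeros (\<lambda>x. f x * g x)) = proj_points (zeros f) \<union> proj_points (zeros g)"
  unfolding zeros_mult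
  by (rule proj_points_Un) (rule zeros_cone[OF assms(1)] zeros_cone[OF assms(2)], assumption)+

lemma form_herm: "form 1 (\<lambda>x. herm x P)"
  by (rule form_linear[OF linear_fun_herm])

lemma tangent_section_eq:
  assumes "\<not> indep P Q" and "P \<noteq> 0" and "Q \<noteq> 0"
  shows "tangent_section P = tangent_section Q"
proof -
  obtain c where "c \<noteq> 0" "Q = c *s P"
    using not_indep_scale[OF assms] by blast
  then have "zeros (\<lambda>x. herm x P) = zeros (\<lambda>x. herm x Q)"
    by (simp add: zeros_def herm_scale_right)
  then show ?thesis
    by simp
qed

lemma card_tangent_section_Un_le:
  assumes P: "P \<noteq> 0" "herm P P = 0" and Q: "Q \<noteq> 0" "herm Q Q = 0"
  shows "card (tangent_section P \<union> tangent_section Q) + q + 1 \<le> 2 * (q ^ 3 + q ^ 2 + 1)"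
proof (cases "indep P Q")
  case True
  have "card (tangent_section P \<union> tangent_section Q) + card (tangent_section P \<inter> tangent_section Q) = 2 * (q ^ 3 + q ^ 2 + 1)"
    using card_Un_Int[of "tangent_section P" "tangent_section Q"] card_tangent_section[OF P] card_tangent_section[OF Q] by simp
  moreover have "q \<le> q ^ 2"
    using q3 by (simp add: power2_eq_square)
  ultimately show ?thesis
    using card_tangent_section_Int[OF True P(2) Q(2)] by linarith
next
  case False
  have "q \<le> q ^ 2"
    using q3 by (simp add: power2_eq_square)
  then show ?thesis
    using tangent_section_eq[OF False P(1) Q(1)] card_tangent_section[OF P] by simp
qed

definition cubic_bound :: "nat \<Rightarrow> bool" where
  "cubic_bound n \<longleftrightarrow> n \<le> 3 * (q ^ 3 + q ^ 2 - q) + q + 1 \<and>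
     (q \<ge> 4 \<longrightarrow> n = 3 * (q ^ 3 + q ^ 2 - q) + q + 1 \<or> n \<le> 3 * (q ^ 3 + q ^ 2 - q) + 1)"

lemma powers_of_q:
  shows "3 * q \<le> q ^ 2" and "q \<ge> 4 \<Longrightarrow> 4 * q \<le> q ^ 2" and "3 * q ^ 2 \<le> q ^ 3"
  using q3 by (simp_all add: power2_eq_square power3_eq_cube)

text \<open>
  Inclusion and exclusion. If the three planes share at most one point of the surface, the
  three pairwise intersections of at least \<open>q + 1\<close> points keep their union within the
  smaller bound. If two of the planes meet inside the third, their intersection cancels
  against the triple one, and the two other intersections decide between equality and a
  smaller number. Coinciding planes leave only two terms.
\<close>

lemma cubic_bound_three_tangent_planes:
  assumes P: "P \<noteq> 0" "herm P P = 0" and Q: "Q \<noteq> 0" "herm Q Q = 0" and R: "R \<noteq> 0" "herm R R = 0"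
  shows "cubic_bound (card (tangent_section P \<union> tangent_section Q \<union> tangent_section R))"
proof (cases "indep P Q \<and> indep P R \<and> indep Q R")
  case True
  define s where "s = q ^ 3 + q ^ 2 + 1"
  have "card (tangent_section P \<union> tangent_section Q \<union> tangent_section R) + card (tangent_section P \<inter> tangent_section Q) + card (tangent_section P \<inter> tangent_section R)
      + card (tangent_section Q \<inter> tangent_section R) = 3 * s + card (tangent_section P \<inter> tangent_section Q \<inter> tangent_section R)"
    using card_Un3[of "tangent_section P" "tangent_section Q" "tangent_section R"] card_tangent_section[OF P] card_tangent_section[OF Q] card_tangent_section[OF R]
    by (simp add: s_def)
  moreover have "card (tangent_section P \<inter> tangent_section Q) = q + 1 \<or> card (tangent_section P \<inter> tangent_section Q) = q ^ 2 + 1"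
      "card (tangent_section P \<inter> tangent_section R) = q + 1 \<or> card (tangent_section P \<inter> tangent_section R) = q ^ 2 + 1"
      "card (tangent_section Q \<inter> tangent_section R) = q + 1 \<or> card (tangent_section Q \<inter> tangent_section R) = q ^ 2 + 1"
    using True card_tangent_section_Int[OF _ P(2) Q(2)] card_tangent_section_Int[OF _ P(2) R(2)] card_tangent_section_Int[OF _ Q(2) R(2)]
    by simp_all
  moreover have "card (tangent_section P \<inter> tangent_section Q \<inter> tangent_section R) = card (tangent_section P \<inter> tangent_section Q) \<or>
      card (tangent_section P \<inter> tangent_section Q \<inter> tangent_section R) \<le> 1"
    using True tangent_section_Int_cases[of P Q R] by (auto simp: Int_absorb2)
  ultimately show ?thesis
    using powers_of_q q3 unfolding cubic_bound_def s_def by auto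
next
  case False
  have le: "card (X \<union> Y) \<le> 2 * (q ^ 3 + q ^ 2 + 1)"
    if "X \<in> {tangent_section P, tangent_section Q, tangent_section R}" "Y \<in> {tangent_section P, tangent_section Q, tangent_section R}" for X Y
    using that card_Un_le[of X Y] card_tangent_section[OF P] card_tangent_section[OF Q] card_tangent_section[OF R] by auto
  have "card (tangent_section P \<union> tangent_section Q \<union> tangent_section R) \<le> 2 * (q ^ 3 + q ^ 2 + 1)"
  proof -
    consider "tangent_section P = tangent_section Q" | "tangent_section P = tangent_section R" | "tangent_section Q = tangent_section R"
      using False tangent_section_eq P Q R by blast
    then show ?thesis
    proof cases
      case 1
      then show ?thesis
        using le[of "tangent_section Q" "tangent_section R"] by simp
    next
      case 2
      then have "tangent_section P \<union> tangent_section Q \<union> tangent_section R = tangent_section Q \<union> tangent_section R"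
        by blast
      then show ?thesis
        using le[of "tangent_section Q" "tangent_section R"] by simp
    next
      case 3
      then have "tangent_section P \<union> tangent_section Q \<union> tangent_section R = tangent_section P \<union> tangent_section R"
        by blast
      then show ?thesis
        using le[of "tangent_section P" "tangent_section R"] by simp
    qed
  qed
  then show ?thesis
    using powers_of_q q3 unfolding cubic_bound_def by auto
qed

text \<open>
  Tangent planes are split off as long as possible. The worst remaining cases are a
  quadratic form that vanishes on no tangent plane and a linear form that vanishes on
  none, next to one or two tangent planes; they are what separates \<open>q = 3\<close> from \<open>q \<ge> 4\<close>.
\<close>

lemma cubic_bound_num_zeros:
  assumes f: "form 3 f" and nonzero: "f x0 \<noteq> 0"
  shows "cubic_bound (num_zeros f)"
proof (cases "\<exists>P. P \<noteq> 0 \<and> herm P P = 0 \<and> (\<forall>x. herm x P = 0 \<longrightarrow> f x = 0)")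
  case False
  have "num_zeros f + q ^ 2 \<le> 3 * q ^ 3 + 3 * q ^ 2 + 1 \<or> num_zeros f \<le> 3 + 1 + (q ^ 2 + 1) * (q * 3)"
    using False q3 by (intro num_zeros_le_no_tangent_plane[OF f]) blast+
  moreover have "(q ^ 2 + 1) * (q * 3) = 3 * q ^ 3 + 3 * q"
    by (simp add: power2_eq_square power3_eq_cube algebra_simps)
  ultimately show ?thesis
    using powers_of_q q3 unfolding cubic_bound_def by auto
next
  case True
  then obtain P where P: "P \<noteq> 0" "herm P P = 0" "\<And>x. herm x P = 0 \<Longrightarrow> f x = 0"
    by blast
  have "\<exists>G. form (3 - 1) G \<and> (\<forall>x. f x = herm x P * G x)"
    by (rule tangent_plane_factor[OF f P(1)]) (erule P(3))
  then obtain G where G: "form (3 - 1) G" "\<forall>x. f x = herm x P * G x"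
    by (elim exE conjE)
  have f_eq: "f = (\<lambda>x. herm x P * G x)"
    using G(2) by (intro ext) (rule spec)
  have points_f: "proj_points (zeros f) = tangent_section P \<union> proj_points (zeros G)"
    unfolding f_eq by (rule proj_points_zeros_mult[OF form_herm G(1)])
  show ?thesis
  proof (cases "\<exists>Q. Q \<noteq> 0 \<and> herm Q Q = 0 \<and> (\<forall>x. herm x Q = 0 \<longrightarrow> G x = 0)")
    case False
    have "num_zeros G + q ^ 2 \<le> (3 - 1) * q ^ 3 + (3 - 1) * q ^ 2 + 1 \<or>
        num_zeros G \<le> (3 - 1) + 1 + (q ^ 2 + 1) * (q * (3 - 1))"
      using False q3 by (intro num_zeros_le_no_tangent_plane[OF G(1)]) (simp, blast)
    moreover have "(q ^ 2 + 1) * (q * (3 - 1)) = 2 * q ^ 3 + 2 * q"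
      by (simp add: power2_eq_square power3_eq_cube algebra_simps)
    moreover have "num_zeros f \<le> q ^ 3 + q ^ 2 + 1 + num_zeros G"
      unfolding points_f using card_Un_le card_tangent_section[OF P(1,2)] by metis
    ultimately show ?thesis
      using powers_of_q q3 unfolding cubic_bound_def by auto
  next
    case True
    then obtain Q where Q: "Q \<noteq> 0" "herm Q Q = 0" "\<And>x. herm x Q = 0 \<Longrightarrow> G x = 0"
      by blast
    have "\<exists>L. form (3 - 1 - 1) L \<and> (\<forall>x. G x = herm x Q * L x)"
      by (rule tangent_plane_factor[OF G(1) Q(1)]) (erule Q(3))
    then obtain L where L: "form (3 - 1 - 1) L" "\<forall>x. G x = herm x Q * L x"
      by (elim exE conjE)
    have G_eq: "G = (\<lambda>x. herm x Q * L x)"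
      using L(2) by (intro ext) (rule spec)
    have points_G: "proj_points (zeros G) = tangent_section Q \<union> proj_points (zeros L)"
      unfolding G_eq by (rule proj_points_zeros_mult[OF form_herm L(1)])
    have points_f': "proj_points (zeros f) = tangent_section P \<union> tangent_section Q \<union> proj_points (zeros L)"
      unfolding points_f points_G by (rule Un_assoc[symmetric])
    show ?thesis
    proof (cases "\<exists>R. R \<noteq> 0 \<and> herm R R = 0 \<and> (\<forall>x. herm x R = 0 \<longrightarrow> L x = 0)")
      case False
      have "num_zeros L + q ^ 2 \<le> (3 - 1 - 1) * q ^ 3 + (3 - 1 - 1) * q ^ 2 + 1 \<or>
          num_zeros L \<le> (3 - 1 - 1) + 1 + (q ^ 2 + 1) * (q * (3 - 1 - 1))"
        using False q3 by (intro num_zeros_le_no_tangent_plane[OF L(1)]) (simp, blast)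
      moreover have "(q ^ 2 + 1) * (q * (3 - 1 - 1)) = q ^ 3 + q"
        by (simp add: power2_eq_square power3_eq_cube algebra_simps)
      moreover have "num_zeros f \<le> card (tangent_section P \<union> tangent_section Q) + num_zeros L"
        unfolding points_f' by (rule card_Un_le)
      moreover have "card (tangent_section P \<union> tangent_section Q) + q + 1 \<le> 2 * (q ^ 3 + q ^ 2 + 1)"
        by (rule card_tangent_section_Un_le[OF P(1,2) Q(1,2)])
      ultimately show ?thesis
        using powers_of_q q3 unfolding cubic_bound_def by auto
    next
      case True
      then obtain R where R: "R \<noteq> 0" "herm R R = 0" "\<And>x. herm x R = 0 \<Longrightarrow> L x = 0"
        by blast
      have "\<exists>K. form (3 - 1 - 1 - 1) K \<and> (\<forall>x. L x = herm x R * K x)"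
        by (rule tangent_plane_factor[OF L(1) R(1)]) (erule R(3))
      then obtain K where K: "form (3 - 1 - 1 - 1) K" "\<forall>x. L x = herm x R * K x"
        by (elim exE conjE)
      have "K x \<noteq> 0" for x
      proof -
        have "K x = K x0"
          using K(1) by (intro form_zero_degree) simp
        then show ?thesis
          using nonzero G(2) L(2) K(2) by auto
      qed
      then have "zeros L = zeros (\<lambda>x. herm x R)"
        using K(2) by (simp add: zeros_def)
      then show ?thesis
        unfolding points_f' using cubic_bound_three_tangent_planes[OF P(1,2) Q(1,2) R(1,2)] by simp
    qed
  qed
qed

lemma V_Int_hermitian_variety:
  "V F \<inter> zero_locus (hermitian_form q A) = proj_points (zeros (mpoly_eval F))"
  by (auto simp: V_def zero_locus_def proj_points_def zeros_def herm_self)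

end

theorem theorem5p3:
  fixes q :: nat
    and V2 :: "('a :: {field, finite} ^ 4) set set"
    and F :: "('a, 4) mpoly"
  assumes "primepow q"
    and "q \<ge> 3"
    and "CARD('a) = q ^ 2"
    and "nondegenerate_hermitian_variety q V2"
    and "F \<noteq> 0"
    and "homogeneous_mpoly 3 F"
  shows "card (V F \<inter> V2) \<le> 3 * (q ^ 3 + q ^ 2 - q) + q + 1 \<and>
         (q \<ge> 4 \<longrightarrow>
            card (V F \<inter> V2) = 3 * (q ^ 3 + q ^ 2 - q) + q + 1 \<or>
            card (V F \<inter> V2) \<le> 3 * (q ^ 3 + q ^ 2 - q) + 1)"
proof -
  obtain A :: "'a ^ 4 ^ 4" where A: "invertible A" "transpose A = power_mat A q"
      "V2 = zero_locus (hermitian_form q A)"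
    using assms(4) unfolding nondegenerate_hermitian_variety_def by (elim exE conjE)
  interpret hermitian_space q A
    by unfold_locales (use assms A in simp_all)
  have "Poly_Mapping.lookup m i < CARD('a) - 1" if "m \<in> Poly_Mapping.keys F" for m and i :: 4
  proof -
    have "Poly_Mapping.lookup m i \<le> (\<Sum>j\<in>UNIV. Poly_Mapping.lookup m j)"
      by (intro member_le_sum) simp_all
    also have "\<dots> = 3"
      using assms(6) that by (simp add: homogeneous_mpoly_def)
    finally show ?thesis
      using powers_of_q(1) assms(2,3) by simp
  qed
  then obtain x0 where "mpoly_eval F x0 \<noteq> 0"
    using mpoly_eval_nonzero[OF assms(5)] by blast
  then have "cubic_bound (num_zeros (mpoly_eval F))"
    by (rule cubic_bound_num_zeros[OF form_mpoly_eval[OF assms(6)]])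
  then show ?thesis
    unfolding A(3) V_Int_hermitian_variety cubic_bound_def .
qed

end
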